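(* Let $\lambda$ be a positive real number and $N$ a nonnegative integer. With $p(\lambda,x)$, $l(\lambda,N;x)$ and $m(\lambda,N;x)$ as defined in the context, the following hold. (i) The inequality $$l(\lambda,N;x)\le p(\lambda,x)\le m(\lambda,N;x)$$ holds at each point $x$ in $\mathbb{R}/\mathbb{Z}$. (ii) There is equality in the inequality on the left in (i) for $x=\frac{n-\frac12}{N+1}$, $n=1,2,\dots,N+1$, and there is equality in the inequality on the right in (i) for $x=\frac{n}{N+1}$, $n=1,2,\dots,N+1$. (iii) If $\widetilde l(x)$ is a real trigonometric polynomial of degree at most $N$ such that $\widetilde l(x)\le p(\lambda,x)$ at each point $x$ in $\mathbb{R}/\mathbb{Z}$, then $$\int_{\mathbb{R}/\mathbb{Z}}\widetilde l(x)\,dx\le\int_{\mathbb{R}/\mathbb{Z}}l(\lambda,N;x)\,dx.$$ (iv) If $\widetilde m(x)$ is a real trigonometric polynomial of degree at most $N$ such that $p(\lambda,x)\le\widetilde m(x)$ at each point $x$ in $\mathbb{R}/\mathbb{Z}$, then $$\int_{\mathbb{R}/\mathbb{Z}}m(\lambda,N;x)\,dx\le\int_{\mathbb{R}/\mathbb{Z}}\widetilde m(x)\,dx.$$ (v) There is equality in the inequality of (iii) if and only if $\widetilde l(x)=l(\lambda,N;x)$, and there is equality in the inequality of (iv) if and only if $\widetilde m(x)=m(\lambda,N;x)$.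
   Context: Write $e(x)=e^{2\pi i x}$, and $\operatorname{sgn}(x)=1,0,-1$ according as $x>0$, $x=0$, $x<0$. Integrals over $\mathbb{R}/\mathbb{Z}$ are with respect to Haar measure of total mass $1$. A real trigonometric polynomial of degree at most $N$ is a real valued function of the form $\sum_{n=-N}^N c_ne(nx)$. For $\lambda>0$ define entire functions (with removable singularities removed) $$L(\lambda,z)=\left(\frac{\cos\pi z}{\pi}\right)^2\left\{\sum_{k\in\mathbb{Z}}\frac{e^{-\lambda|k+\frac12|}}{(z-k-\frac12)^2}-\lambda\sum_{l\in\mathbb{Z}}\frac{\operatorname{sgn}(l+\frac12)e^{-\lambda|l+\frac12|}}{z-l-\frac12}\right\},$$ $$M(\lambda,z)=\left(\frac{\sin\pi z}{\pi}\right)^2\left\{\sum_{k\in\mathbb{Z}}\frac{e^{-\lambda|k|}}{(z-k)^2}-\lambda\sum_{l\in\mathbb{Z}}\frac{\operatorname{sgn}(l)e^{-\lambda|l|}}{z-l}\right\}.$$ Both are integrable on $\mathbb{R}$; put $\widehat L(\lambda,t)=\int_{-\infty}^\infty L(\lambda,x)e(-tx)\,dx$ and $\widehat M(\lambda,t)=\int_{-\infty}^\infty M(\lambda,x)e(-tx)\,dx$. These are continuous in $t$ and supported on $[-1,1]$, with $\widehat L(\lambda,0)=\operatorname{csch}(\lambda/2)$ and $\widehat M(\lambda,0)=\coth(\lambda/2)$. Define $$l(\lambda,N;x)=-\tfrac2\lambda+\tfrac1{N+1}\sum_{n=-N}^N\widehat L\left(\tfrac{\lambda}{N+1},\tfrac{n}{N+1}\right)e(nx),$$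 $$m(\lambda,N;x)=-\tfrac2\lambda+\tfrac1{N+1}\sum_{n=-N}^N\widehat M\left(\tfrac{\lambda}{N+1},\tfrac{n}{N+1}\right)e(nx),$$ $$p(\lambda,x)=-\tfrac2\lambda+\sum_{m=-\infty}^\infty e^{-\lambda|x+m|}.$$ *)

theory Defs
  imports "HOL-Complex_Analysis.Complex_Analysis"
begin

definition unit_exp :: "real \<Rightarrow> complex" where
  "unit_exp x = exp (2 * of_real pi * \<i> * of_real x)"

(* The displayed series only make sense away from the half-integers (resp. the integers),
   where division by zero returns junk; remove_sings then passes to the entire extension.
   For lam > 0 all four series converge absolutely, so infsum is the usual sum. *)
definition L_fun :: "real \<Rightarrow> complex \<Rightarrow> complex" where
  "L_fun lam = remove_sings (\<lambda>z. (cos (of_real pi * z) / of_real pi)\<^sup>2 *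
     ((\<Sum>\<^sub>\<infinity>k::int. of_real (exp (- lam * \<bar>of_int k + 1/2\<bar>)) / (z - of_int k - 1/2)\<^sup>2)
      - of_real lam * (\<Sum>\<^sub>\<infinity>l::int. of_real (sgn (of_int l + 1/2) * exp (- lam * \<bar>of_int l + 1/2\<bar>))
                       / (z - of_int l - 1/2))))"

definition M_fun :: "real \<Rightarrow> complex \<Rightarrow> complex" where
  "M_fun lam = remove_sings (\<lambda>z. (sin (of_real pi * z) / of_real pi)\<^sup>2 *
     ((\<Sum>\<^sub>\<infinity>k::int. of_real (exp (- lam * \<bar>of_int k\<bar>)) / (z - of_int k)\<^sup>2)
      - of_real lam * (\<Sum>\<^sub>\<infinity>l::int. of_real (sgn (of_int l) * exp (- lam * \<bar>of_int l\<bar>))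
                       / (z - of_int l))))"

definition L_hat :: "real \<Rightarrow> real \<Rightarrow> complex" where
  "L_hat lam t = (LBINT x. L_fun lam (of_real x) * unit_exp (- t * x))"

definition M_hat :: "real \<Rightarrow> real \<Rightarrow> complex" where
  "M_hat lam t = (LBINT x. M_fun lam (of_real x) * unit_exp (- t * x))"

(* Functions on R/Z are represented as functions of a real variable of period 1.
   l_poly and m_poly are real-valued, but are typed as complex so that nothing is discarded
   from the defining sums; they are compared with reals through the library's partial order
   on complex, for which z <= w means Re z <= Re w and Im z = Im w. *)
definition l_poly :: "real \<Rightarrow> nat \<Rightarrow> real \<Rightarrow> complex" where
  "l_poly lam N x = - of_real (2 / lam) + 1 / of_nat (N + 1) *
     (\<Sum>n = - int N..int N. L_hat (lam / real (N + 1)) (of_int n / real (N + 1)) * unit_exp (of_int n * x))"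

definition m_poly :: "real \<Rightarrow> nat \<Rightarrow> real \<Rightarrow> complex" where
  "m_poly lam N x = - of_real (2 / lam) + 1 / of_nat (N + 1) *
     (\<Sum>n = - int N..int N. M_hat (lam / real (N + 1)) (of_int n / real (N + 1)) * unit_exp (of_int n * x))"

definition p_fun :: "real \<Rightarrow> real \<Rightarrow> real" where
  "p_fun lam x = - (2 / lam) + (\<Sum>\<^sub>\<infinity>m::int. exp (- lam * \<bar>x + of_int m\<bar>))"

definition real_trig_poly :: "nat \<Rightarrow> (real \<Rightarrow> real) \<Rightarrow> bool" where
  "real_trig_poly N f \<longleftrightarrow>
     (\<exists>c :: int \<Rightarrow> complex. \<forall>x. of_real (f x) = (\<Sum>n = - int N..int N. c n * unit_exp (of_int n * x)))"

definition circle_integral :: "(real \<Rightarrow> 'a::{banach, second_countable_topology}) \<Rightarrow> 'a" where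
  "circle_integral f = (LBINT x:{0..<1}. f x)"

end

theory Submission
  imports Defs "HOL-Probability.Sinc_Integral"
begin

text \<open>
  For \<open>\<bar>t\<bar> < 1\<close> the transforms of \<open>L\<close> and \<open>M\<close> are computed termwise, so the coefficients of \<open>l\<close> and \<open>m\<close>
  are explicit. With \<open>s = 1/2\<close> for \<open>l\<close> and \<open>s = 0\<close> for \<open>m\<close>, pairing the frequencies \<open>n\<close> and
  \<open>n - (N + 1)\<close> shows that the polynomial agrees with \<open>p\<close> at the nodes \<open>(j + s)/(N + 1)\<close>, to first
  order except at the corner \<open>0\<close> of \<open>p\<close>. On \<open>[0,1]\<close>, \<open>p\<close> is a constant plus a combination of
  \<open>exp (\<plusminus>\<lambda>x)\<close>. Hence, by Rolle's theorem for \<open>D\<^sup>2 - \<lambda>\<^sup>2\<close>, the difference from \<open>p\<close> has at most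
  \<open>2N + 2\<close> zeros there. The interpolation conditions account for all of them, so the difference does not
  change sign. Extremality follows from the quadrature formula at the nodes, which is exact in degree \<open>N\<close>;
  in the case of equality the difference of the two polynomials has more than \<open>2N\<close> zeros in a period.
\<close>

section \<open>Zeros of trigonometric polynomials\<close>

text \<open>The bound 2N + 2 has two sources: D^2 - lambda^2 annihilates the exponentials and maps
  the polynomial to one of degree N, which has at most 2N zeros in a period, and each of the two
  first order factors costs one zero in Rolle's theorem. The bound is attained: for m there are N
  double zeros inside and simple zeros at 0 and 1, for l there are N + 1 double zeros inside.

  The sign near 0 needs its own argument. For m it comes from the corner of p. For l nothing is
  prescribed at 0, but a wrong sign there would give the derivative of the difference too many
  zeros.

  Only frequencies of absolute value at most N occur, so the transforms enter only for abs t < 1.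
  The obstacle is that sin^2(pi x)/(x - l) is not absolutely integrable. Since the signed weights
  sum to 0, each 1/(x - l) may be replaced by 1/(x - l) - 1/x, which is integrable together with the
  sine factor.

  The constant -2/lambda, which gives p mean 0, occurs on both sides of every comparison and is
  carried along only at the end.\<close>

lemma unit_exp_0 [simp]: "unit_exp 0 = 1"
  by (simp add: unit_exp_def)

lemma unit_exp_add: "unit_exp (x + y) = unit_exp x * unit_exp y"
  by (simp add: unit_exp_def exp_add ring_distribs)

lemma unit_exp_eq_cis: "unit_exp x = cis (2 * pi * x)"
  by (simp add: unit_exp_def cis_conv_exp mult_ac)

lemma norm_unit_exp [simp]: "norm (unit_exp x) = 1"
  by (simp add: unit_exp_eq_cis)

lemma unit_exp_nonzero [simp]: "unit_exp x \<noteq> 0"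
  by (simp add: unit_exp_def)

lemma unit_exp_of_int [simp]: "unit_exp (of_int n) = 1"
  by (simp add: unit_exp_eq_cis cis_multiple_2pi)

lemma unit_exp_minus: "unit_exp (- x) = inverse (unit_exp x)"
  by (simp add: unit_exp_def exp_minus)

lemma cnj_unit_exp [simp]: "cnj (unit_exp x) = unit_exp (- x)"
  by (simp add: unit_exp_eq_cis cis_cnj)

lemma unit_exp_of_nat_mult: "unit_exp (of_nat n * x) = unit_exp x ^ n"
  unfolding unit_exp_eq_cis Complex.DeMoivre by (simp add: mult_ac)

lemma unit_exp_eq_1_iff: "unit_exp x = 1 \<longleftrightarrow> x \<in> \<int>"
proof -
  have "unit_exp x = 1 \<longleftrightarrow> (\<exists>n::int. 2 * pi * x = of_int (2 * n) * pi)"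
    unfolding unit_exp_def exp_eq_1 by simp
  also have "\<dots> \<longleftrightarrow> (\<exists>n::int. x = of_int n)" by (auto simp: field_simps)
  finally show ?thesis by (auto elim: Ints_cases)
qed

lemma has_vector_derivative_unit_exp:
  "((\<lambda>x. unit_exp (a * x)) has_vector_derivative (2 * of_real pi * \<i> * of_real a * unit_exp (a * x))) (at x within S)"
  unfolding unit_exp_def
  by (rule has_vector_derivative_real_field derivative_eq_intros refl | simp)+

lemma continuous_on_unit_exp [continuous_intros]:
  "continuous_on S f \<Longrightarrow> continuous_on S (\<lambda>x. unit_exp (f x))"
  unfolding unit_exp_def by (intro continuous_intros)

lemma borel_measurable_unit_exp [measurable]: "unit_exp \<in> borel_measurable borel"
  by (intro borel_measurable_continuous_onI continuous_intros)

lemma inj_on_unit_exp: "inj_on unit_exp {a..<a+1}"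
proof (rule inj_onI)
  fix x y assume *: "x \<in> {a..<a+1}" "y \<in> {a..<a+1}" "unit_exp x = unit_exp y"
  have "unit_exp (x - y) = 1"
    using *(3) unit_exp_add[of x "-y"] by (simp add: unit_exp_minus)
  then obtain n where n: "x - y = of_int n" by (auto simp: unit_exp_eq_1_iff elim: Ints_cases)
  moreover have "\<bar>x - y\<bar> < 1" using * by auto
  ultimately have "n = 0" by linarith
  with n show "x = y" by simp
qed

text \<open>Multiplication by \<open>unit_exp (of_nat N * x)\<close> turns \<open>f\<close> into an
  ordinary polynomial of degree at most 2N in \<open>unit_exp x\<close>, and \<open>unit_exp\<close>
  is injective on a half-open period.\<close>

lemma real_trig_poly_zero:
  assumes "real_trig_poly N f" "finite Z" "Z \<subseteq> {a..<a+1}" "\<And>z. z \<in> Z \<Longrightarrow> f z = 0" "card Z \<ge> 2 * N + 1"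
  shows "f x = 0"
proof -
  obtain c where c: "\<And>x. of_real (f x) = (\<Sum>n = - int N..int N. c n * unit_exp (of_int n * x))"
    using assms(1) by (auto simp: real_trig_poly_def)
  define q where "q = (\<Sum>k\<le>2*N. monom (c (int k - int N)) k)"
  have deg: "degree q \<le> 2 * N"
    unfolding q_def by (rule degree_sum_le) (auto intro: order_trans[OF degree_monom_le])
  have q: "poly q (unit_exp x) = unit_exp (of_nat N * x) * of_real (f x)" for x
  proof -
    have "unit_exp (of_nat N * x) * of_real (f x) =
          (\<Sum>n = - int N..int N. c n * unit_exp (of_int (n + int N) * x))"
      unfolding c sum_distrib_left
      by (intro sum.cong refl) (simp add: unit_exp_add ring_distribs)
    also have "\<dots> = (\<Sum>k\<le>2*N. c (int k - int N) * unit_exp (of_nat k * x))"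
      by (rule sum.reindex_bij_witness[of _ "\<lambda>k. int k - int N" "\<lambda>n. nat (n + int N)"]) auto
    finally show ?thesis
      by (simp add: q_def poly_sum poly_monom unit_exp_of_nat_mult)
  qed
  have "q = 0"
  proof (rule ccontr)
    assume "q \<noteq> 0"
    have "unit_exp ` Z \<subseteq> {z. poly q z = 0}" using assms(4) by (auto simp: q)
    then have "card (unit_exp ` Z) \<le> card {z. poly q z = 0}"
      using \<open>q \<noteq> 0\<close> by (intro card_mono poly_roots_finite)
    also have "\<dots> \<le> degree q" using \<open>q \<noteq> 0\<close> by (rule card_poly_roots_bound)
    also have "card (unit_exp ` Z) = card Z"
      using inj_on_unit_exp[of a] assms(3) by (intro card_image) (auto intro: inj_on_subset)
    finally show False using deg assms(5) by simp
  qed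
  then show ?thesis using q[of x] by simp
qed

lemma real_trig_poly_derivative:
  assumes "real_trig_poly N f"
  obtains g where "real_trig_poly N g" "\<And>x. (f has_real_derivative g x) (at x)"
proof -
  obtain c where c: "\<And>x. of_real (f x) = (\<Sum>n = - int N..int N. c n * unit_exp (of_int n * x))"
    using assms by (auto simp: real_trig_poly_def)
  define d where "d = (\<lambda>n::int. c n * (2 * of_real pi * \<i> * of_int n))"
  define h where "h x = (\<Sum>n = - int N..int N. d n * unit_exp (of_int n * x))" for x
  have der: "((\<lambda>x. complex_of_real (f x)) has_vector_derivative h x) (at x)" for x
    unfolding c h_def d_def
    by (rule derivative_eq_intros has_vector_derivative_unit_exp refl | simp add: mult_ac)+
  have 1: "(f has_real_derivative Re (h x)) (at x)" for x
    using bounded_linear.has_vector_derivative[OF bounded_linear_Re der[of x]] 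
    by (simp add: has_real_derivative_iff_has_vector_derivative)
  \<comment> \<open>Conjugate symmetry of the coefficients is not assumed; the derivative is real
    because the imaginary part of \<open>f\<close>, as a complex function, is constantly 0.\<close>
  have "Im (h x) = 0" for x
    using bounded_linear.has_vector_derivative[OF bounded_linear_Im der[of x]] vector_derivative_unique_at[of "\<lambda>_. 0::real" "Im (h x)" x 0]
    by simp
  then have "of_real (Re (h x)) = h x" for x by (simp add: complex_eq_iff)
  then have 2: "real_trig_poly N (\<lambda>x. Re (h x))"
    by (auto simp: real_trig_poly_def h_def)
  show thesis by (rule that[OF 2 1])
qed

lemma real_trig_poly_lincomb:
  assumes "real_trig_poly N f" "real_trig_poly N g"
  shows "real_trig_poly N (\<lambda>x. a * f x + b * g x)"
proof -
  obtain c d where c: "\<And>x. of_real (f x) = (\<Sum>n = - int N..int N. c n * unit_exp (of_int n * x))"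
    and d: "\<And>x. of_real (g x) = (\<Sum>n = - int N..int N. d n * unit_exp (of_int n * x))"
    using assms by (auto simp: real_trig_poly_def)
  show ?thesis unfolding real_trig_poly_def
    by (rule exI[of _ "\<lambda>n. of_real a * c n + of_real b * d n"])
       (simp add: c d sum_distrib_left sum.distrib ring_distribs mult_ac)
qed

lemma real_trig_poly_periodic:
  assumes "real_trig_poly N f" shows "f (x + of_int m) = f x"
proof -
  obtain c where c: "\<And>x. of_real (f x) = (\<Sum>n = - int N..int N. c n * unit_exp (of_int n * x))"
    using assms by (auto simp: real_trig_poly_def)
  have "unit_exp (of_int n * (x + of_int m)) = unit_exp (of_int n * x)" for n
    using unit_exp_of_int[of "n*m"] by (simp add: ring_distribs unit_exp_add)
  then have "complex_of_real (f (x + of_int m)) = of_real (f x)" by (simp add: c)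
  then show ?thesis by simp
qed

section \<open>Rolle's theorem for first order operators, and the zero count\<close>

lemma Rolle_exp:
  fixes u :: "real \<Rightarrow> real"
  assumes "a < b" "u a = 0" "u b = 0" and der: "\<And>x. (u has_real_derivative u' x) (at x)"
  obtains z where "a < z" "z < b" "u' z + k * u z = 0"
proof -
  \<comment> \<open>The integrating factor for \<open>u' + k * u\<close> reduces the claim to the
    usual theorem of Rolle.\<close>
  define g where "g x = exp (k * x) * u x" for x
  have g: "(g has_real_derivative exp (k * x) * (u' x + k * u x)) (at x)" for x
    unfolding g_def by (auto intro!: derivative_eq_intros der simp: algebra_simps)
  have "continuous_on {a..b} g"
    using DERIV_isCont[OF g] by (intro continuous_at_imp_continuous_on) auto
  then have "\<exists>z. a < z \<and> z < b \<and> (g has_real_derivative 0) (at z)"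
    using assms g by (intro Rolle) (auto simp: g_def[of a] g_def[of b] real_differentiable_def)
  then obtain z where z: "a < z" "z < b" "(g has_real_derivative 0) (at z)" by blast
  then have "exp (k * z) * (u' z + k * u z) = 0" using DERIV_unique g by blast
  then show thesis using that z by simp
qed

text \<open>Each gap between neighbours contributes one zero. Disjointness from \<open>Z\<close> is
  recorded because double zeros, which belong to \<open>Z\<close>, are later adjoined to
  \<open>Z'\<close> and must count as additional points.\<close>

lemma Rolle_finite_set:
  fixes u :: "real \<Rightarrow> real"
  assumes "finite Z" and "\<And>z. z \<in> Z \<Longrightarrow> u z = 0" and der: "\<And>x. (u has_real_derivative u' x) (at x)"
  shows "\<exists>Z'. finite Z' \<and> card Z' = card Z - 1 \<and> Z' \<inter> Z = {} \<and>
           (\<forall>z\<in>Z'. u' z + k * u z = 0 \<and> (\<exists>a\<in>Z. a < z) \<and> (\<exists>b\<in>Z. z < b))"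
  using assms(1,2)
proof (induction Z rule: finite_linorder_max_induct)
  case empty
  then show ?case by auto
next
  case (insert b Z)
  show ?case
  proof (cases "Z = {}")
    case True
    then show ?thesis by auto
  next
    case False
    obtain Z' where Z': "finite Z'" "card Z' = card Z - 1" "Z' \<inter> Z = {}"
      "\<And>z. z \<in> Z' \<Longrightarrow> u' z + k * u z = 0 \<and> (\<exists>a\<in>Z. a < z) \<and> (\<exists>b\<in>Z. z < b)"
      using insert.IH insert.prems by (metis insertI2)
    define a where "a = Max Z"
    have a: "a \<in> Z" "\<And>z. z \<in> Z \<Longrightarrow> z \<le> a" using False insert(1) by (auto simp: a_def)
    obtain z where z: "a < z" "z < b" "u' z + k * u z = 0"
      by (rule Rolle_exp[of a b u u' k]) (use a insert der in auto)
    have le: "w < a" if "w \<in> Z'" for w using Z'(4)[OF that] a by force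
    have "z \<notin> Z'" using le z by force
    moreover have "card Z > 0" using False insert(1) by (simp add: card_gt_0_iff)
    moreover have "b \<notin> Z" using insert by auto
    moreover have "w \<noteq> b" if "w \<in> Z'" for w using le[OF that] a insert(2) by force
    moreover have "z \<notin> Z" using z a by force
    ultimately have "card (insert z Z') = card (insert b Z) - 1" "insert z Z' \<inter> insert b Z = {}"
      using insert(1) Z' z by auto
    moreover have "u' y + k * u y = 0 \<and> (\<exists>a\<in>insert b Z. a < y) \<and> (\<exists>b\<in>insert b Z. y < b)" 
      if "y \<in> insert z Z'" for y
      using that z a(1) Z'(4)[of y] by blast
    ultimately show ?thesis using Z'(1)
      by (intro exI[of _ "insert z Z'"]) simp
  qed
qed

text \<open>Applying \<open>D\<^sup>2 - \<lambda>\<^sup>2\<close>, i.e. Rolle for \<open>D + \<lambda>\<close> and then for \<open>D - \<lambda>\<close>, loses two zeros, kills \<open>q\<close>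
  and leaves a trigonometric polynomial of the same degree.\<close>
lemma exp_trig_zero_count:
  fixes T q :: "real \<Rightarrow> real"
  assumes lam: "lam > 0" and T: "real_trig_poly N T"
    and f: "\<And>x. f x = T x - q x"
    and f1: "\<And>x. (f has_real_derivative f1 x) (at x)"
    and f2: "\<And>x. (f1 has_real_derivative f2 x) (at x)"
    and q1: "\<And>x. (q has_real_derivative q1 x) (at x)"
    and q2: "\<And>x. (q1 has_real_derivative lam\<^sup>2 * q x) (at x)"
    and Z: "finite Z" "Z \<subseteq> {0..1}" "\<And>z. z \<in> Z \<Longrightarrow> f z = 0"
    and D: "D \<subseteq> Z" "D \<subseteq> {0<..<1}" "\<And>z. z \<in> D \<Longrightarrow> f1 z = 0"
    and E: "E \<subseteq> D" "\<And>z. z \<in> E \<Longrightarrow> f2 z = 0"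
    and card: "card Z + card D + card E \<ge> 2 * N + 3"
  shows "T x = 0"
proof -
  have fin: "finite D" "finite E"
    using finite_subset[OF D(1) Z(1)] finite_subset[OF E(1)] by auto
  obtain T1 where T1: "real_trig_poly N T1" "\<And>x. (T has_real_derivative T1 x) (at x)"
    using real_trig_poly_derivative[OF T] by blast
  obtain T2 where T2: "real_trig_poly N T2" "\<And>x. (T1 has_real_derivative T2 x) (at x)"
    using real_trig_poly_derivative[OF T1(1)] by blast
  have f1_eq: "f1 x = T1 x - q1 x" for x
  proof (rule DERIV_unique[OF f1])
    have "((\<lambda>x. T x - q x) has_real_derivative T1 x - q1 x) (at x)"
      by (intro derivative_intros T1 q1)
    then show "(f has_real_derivative T1 x - q1 x) (at x)" by (simp add: f[abs_def])
  qed
  have f2_eq: "f2 x = T2 x - lam\<^sup>2 * q x" for x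
  proof (rule DERIV_unique[OF f2])
    have "((\<lambda>x. T1 x - q1 x) has_real_derivative T2 x - lam\<^sup>2 * q x) (at x)"
      by (intro derivative_intros T2 q2)
    then show "(f1 has_real_derivative T2 x - lam\<^sup>2 * q x) (at x)" by (simp add: f1_eq[abs_def])
  qed
  define g where "g x = f1 x + lam * f x" for x
  define g' where "g' x = f2 x + lam * f1 x" for x
  have g': "(g has_real_derivative g' x) (at x)" for x
    unfolding g_def g'_def by (auto intro!: derivative_eq_intros f1 f2)
  \<comment> \<open>\<open>G\<close> is both T'' - lam^2 T and f'' - lam^2 f, since q'' = lam^2 q.
    The first form shows that it has degree N, the second that it equals (D - lam)(D + lam) f and so
    inherits zeros from \<open>f\<close>.\<close>
  define G where "G x = 1 * T2 x + (- (lam\<^sup>2)) * T x" for x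
  have G: "real_trig_poly N G"
    unfolding G_def by (rule real_trig_poly_lincomb[OF T2(1) T])
  have G_eq: "G x = g' x + (- lam) * g x" for x
    by (simp add: G_def g'_def g_def f1_eq f2_eq f power2_eq_square algebra_simps)
  obtain Z1 where Z1: "finite Z1" "card Z1 = card Z - 1" "Z1 \<inter> Z = {}"
      "\<And>z. z \<in> Z1 \<Longrightarrow> f1 z + lam * f z = 0 \<and> (\<exists>a\<in>Z. a < z) \<and> (\<exists>b\<in>Z. z < b)"
    using Rolle_finite_set[OF Z(1,3) f1, where k = lam] by blast
  have Z1': "Z1 \<union> D \<subseteq> {0<..<1}"
  proof
    fix z assume "z \<in> Z1 \<union> D"
    then show "z \<in> {0<..<1}"
    proof
      assume "z \<in> Z1"
      then obtain a b where "a \<in> Z" "a < z" "b \<in> Z" "z < b" using Z1(4) by blast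
      moreover have "0 \<le> a" "b \<le> 1" using Z(2) calculation by auto
      ultimately show ?thesis by auto
    qed (use D in auto)
  qed
  obtain Z2 where Z2: "finite Z2" "card Z2 = card (Z1 \<union> D) - 1" "Z2 \<inter> (Z1 \<union> D) = {}"
      "\<And>z. z \<in> Z2 \<Longrightarrow> g' z + (-lam) * g z = 0 \<and> (\<exists>a\<in>Z1 \<union> D. a < z) \<and> (\<exists>b\<in>Z1 \<union> D. z < b)"
  proof -
    have "g z = 0" if "z \<in> Z1 \<union> D" for z
      using that Z1(4)[of z] D(1,3) Z(3) by (auto simp: g_def)
    moreover have "finite (Z1 \<union> D)" using Z1(1) fin by simp
    ultimately show ?thesis
      using Rolle_finite_set[of "Z1 \<union> D" g g' "-lam", OF _ _ g'] that by blast
  qed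
  \<comment> \<open>\<open>g\<close> has card Z - 1 + card D zeros, and one is lost in the next
    step. Points of \<open>E\<close>, where \<open>f\<close>, \<open>f1\<close> and
    \<open>f2\<close> all vanish, survive both steps. The inclusions of \<open>E\<close> in
    \<open>D\<close> and of \<open>D\<close> in \<open>Z\<close> guarantee that neither subtraction
    is truncated.\<close>
  have "card (Z2 \<union> E) = card Z2 + card E"
    using Z2 E fin by (intro card_Un_disjoint) auto
  moreover have "card (Z1 \<union> D) = card Z1 + card D"
    using Z1 D fin by (intro card_Un_disjoint) auto
  moreover have "card D \<le> card Z" "card E \<le> card D"
    using Z D E fin by (auto intro!: card_mono)
  ultimately have "card (Z2 \<union> E) \<ge> 2 * N + 1"
    using card Z1(2) Z2(2) by linarith
  moreover have "Z2 \<union> E \<subseteq> {0..<0+1}"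
  proof
    fix z assume "z \<in> Z2 \<union> E"
    then show "z \<in> {0..<0+1}"
    proof
      assume "z \<in> Z2"
      then obtain a b where "a \<in> Z1 \<union> D" "a < z" "b \<in> Z1 \<union> D" "z < b" using Z2(4) by blast
      moreover have "0 < a" "b < 1" using Z1' calculation by auto
      ultimately show ?thesis by auto
    next
      assume "z \<in> E"
      then show ?thesis using E(1) D(2) by auto
    qed
  qed
  moreover have "G z = 0" if "z \<in> Z2 \<union> E" for z
  proof (cases "z \<in> Z2")
    case True
    then show ?thesis using Z2(4)[of z] by (simp add: G_eq)
  next
    case False
    then have "z \<in> E" "z \<in> D" "z \<in> Z" using that E(1) D(1) by auto
    then show ?thesis using E(2) D(3) Z(3) by (simp add: G_eq g_def g'_def)
  qed
  moreover have "finite (Z2 \<union> E)" using Z2(1) fin(2) by simp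
  ultimately have G0: "G x = 0" for x
    by (metis (no_types) real_trig_poly_zero[OF G])
  \<comment> \<open>It remains to see that a periodic solution of \<open>T'' = \<lambda>\<^sup>2 T\<close> vanishes.\<close>
  define w where "w x = exp (- lam * x) * (T1 x + lam * T x)" for x
  have w0: "T1 x + lam * T x = 0" for x
  proof -
    have "(w has_real_derivative exp (- lam * y) * G y) (at y)" for y
      unfolding w_def
      by (rule derivative_eq_intros T1(2) T2(2) refl)+ 
         (simp add: G_def power2_eq_square algebra_simps)
    then have "(w has_real_derivative 0) (at y)" for y
      using G0 by simp
    then have "w x = w (x + 1)" using DERIV_const_ratio_const[of x "x+1" w 0] by fastforce
    moreover have "w (x + 1) = exp (- lam * x) * exp (- lam) * (T1 x + lam * T x)"
      using real_trig_poly_periodic[OF T, of x 1] real_trig_poly_periodic[OF T1(1), of x 1]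
      by (simp add: w_def ring_distribs exp_add exp_diff exp_minus field_simps)
    moreover have "exp (- lam * x) * ((T1 x + lam * T x) * (1 - exp (- lam))) =
        w x - exp (- lam * x) * exp (- lam) * (T1 x + lam * T x)"
      unfolding w_def by (simp only: algebra_simps)
    ultimately have "exp (- lam * x) * ((T1 x + lam * T x) * (1 - exp (- lam))) = 0"
      by simp
    then show ?thesis using lam by simp
  qed
  define v where "v x = exp (lam * x) * T x" for x
  have "(v has_real_derivative exp (lam * y) * (T1 y + lam * T y)) (at y)" for y
    unfolding v_def by (rule derivative_eq_intros T1(2) refl)+ (simp add: algebra_simps)
  then have "(v has_real_derivative 0) (at y)" for y
    using w0 by simp
  then have "v x = v (x + 1)" using DERIV_const_ratio_const[of x "x+1" v 0] by fastforce
  moreover have "v (x + 1) = exp (lam * x) * exp lam * T x"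
    using real_trig_poly_periodic[OF T, of x 1] by (simp add: v_def ring_distribs exp_add)
  moreover have "exp (lam * x) * (T x * (1 - exp lam)) = v x - exp (lam * x) * exp lam * T x"
    unfolding v_def by (simp only: algebra_simps)
  ultimately have "exp (lam * x) * (T x * (1 - exp lam)) = 0"
    by simp
  then show ?thesis using lam by simp
qed

section \<open>One-sided interpolation of hyperbolic functions\<close>

text \<open>At the infimum of the points where \<open>f\<close> is negative, \<open>f\<close>
  vanishes and has a strict local extremum. A minimum contradicts negative values just to the right,
  a maximum contradicts nonnegativity to the left. The assumption on \<open>d\<close> keeps the
  infimum away from 0, where a zero need not be double.\<close>

lemma nonneg_of_double_zeros:
  fixes f :: "real \<Rightarrow> real"
  assumes f1: "\<And>x. (f has_real_derivative f1 x) (at x)"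
    and f2: "\<And>x. (f1 has_real_derivative f2 x) (at x)"
    and d: "d > 0" "\<And>x. 0 < x \<Longrightarrow> x < d \<Longrightarrow> f x > 0"
    and zeros: "\<And>z. 0 < z \<Longrightarrow> z < 1 \<Longrightarrow> f z = 0 \<Longrightarrow> f1 z = 0 \<and> f2 z \<noteq> 0"
    and x: "0 < x" "x \<le> 1"
  shows "f x \<ge> 0"
proof (rule ccontr)
  assume neg: "\<not> f x \<ge> 0"
  define S where "S = {x. 0 < x \<and> x \<le> 1 \<and> f x < 0}"
  define z where "z = Inf S"
  have S: "x \<in> S" "bdd_below S" using x neg by (auto simp: S_def intro!: bdd_belowI[of _ 0])
  have cont: "isCont f y" for y using f1 by (rule DERIV_isCont)
  have "d \<le> y" if "y \<in> S" for y using that d(2)[of y] by (force simp: S_def)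
  then have z0: "z > 0" using S d(1) cInf_greatest[of S d] by (force simp: z_def)
  have left: "f y \<ge> 0" if "0 < y" "y < z" for y
  proof (rule ccontr)
    assume "\<not> f y \<ge> 0"
    moreover have "z \<le> x" unfolding z_def using S by (intro cInf_lower)
    ultimately have "y \<in> S" using that x by (auto simp: S_def)
    then have "z \<le> y" unfolding z_def using S by (intro cInf_lower)
    then show False using that by simp
  qed
  have right: "\<exists>y\<in>S. z \<le> y \<and> y < z + e" if "e > 0" for e
    using cInf_lessD[of S "z + e"] S that cInf_lower[OF _ S(2)] by (auto simp: z_def)
  have fz: "f z = 0"
  proof (rule ccontr)
    assume "f z \<noteq> 0"
    then have "\<bar>f z\<bar> > 0" by simp
    with cont[of z] obtain e where e: "e > 0" "\<And>y. \<bar>y - z\<bar> < e \<Longrightarrow> \<bar>f y - f z\<bar> < \<bar>f z\<bar>"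
      unfolding continuous_at_eps_delta dist_real_def by blast
    show False
    proof (cases "f z < 0")
      case True
      \<comment> \<open>This point lies to the left of \<open>z\<close>, is still positive and is
        closer to \<open>z\<close> than \<open>e\<close>, so that \<open>left\<close> applies to
        it.\<close>
      have "\<bar>f (max (z/2) (z - e/2)) - f z\<bar> < \<bar>f z\<bar>" using e z0 by (intro e) auto
      moreover have "f (max (z/2) (z - e/2)) \<ge> 0" using e z0 by (intro left) auto
      ultimately show False using True by linarith
    next
      case False
      obtain y where "y \<in> S" "z \<le> y" "y < z + e" using right e by blast
      then show False using e(2)[of y] False by (auto simp: S_def)
    qed
  qed
  have "z \<le> x" unfolding z_def using S by (intro cInf_lower)
  moreover have "z \<noteq> x" using fz neg by auto
  ultimately have "z < 1" using x by simp
  with zeros z0 fz have *: "f1 z = 0" "f2 z \<noteq> 0" by auto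
  show False
  proof (cases "f2 z > 0")
    case True
    from DERIV_pos_inc_right[OF f2 this] obtain e where
      e: "e > 0" "\<And>h. 0 < h \<Longrightarrow> h < e \<Longrightarrow> 0 < f1 (z + h)" using * by auto
    obtain y where y: "y \<in> S" "z \<le> y" "y < z + e" using right e by blast
    have "z \<noteq> y" using fz y by (auto simp: S_def)
    then have "f z < f y" using y e(2)
      by (intro DERIV_pos_imp_increasing_open[of z y f] continuous_at_imp_continuous_on ballI cont)
         (auto intro!: exI[of _ "f1 _"] f1 e(2)[of "_ - z", simplified])
    then show False using fz y by (auto simp: S_def)
  next
    case False
    then have "f2 z < 0" using * by simp
    from DERIV_neg_dec_left[OF f2 this] obtain e where
      e: "e > 0" "\<And>h. 0 < h \<Longrightarrow> h < e \<Longrightarrow> 0 < f1 (z - h)" using * by auto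
    define y where "y = max (z/2) (z - e/2)"
    have y: "0 < y" "y < z" "z - e < y" using z0 e by (auto simp: y_def)
    then have "f y < f z" using e(2)
      by (intro DERIV_pos_imp_increasing_open[of y z f] continuous_at_imp_continuous_on ballI cont)
         (auto intro!: exI[of _ "f1 _"] f1 e(2)[of "z - _", simplified])
    then show False using fz left[of y] y by simp
  qed
qed

section \<open>Periodized exponentials on the unit interval\<close>

lemma has_sum_int:
  fixes f :: "int \<Rightarrow> 'a::{topological_comm_monoid_add}"
  assumes "((\<lambda>n. f (int n)) has_sum a) UNIV" "((\<lambda>n. f (- 1 - int n)) has_sum b) UNIV"
  shows "(f has_sum (a + b)) UNIV"
proof -
  have "(f has_sum a) (range int)"
    by (subst has_sum_reindex) (use assms(1) in \<open>auto simp: o_def inj_on_def\<close>)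
  moreover have "(f has_sum b) (range (\<lambda>n. - 1 - int n))"
    by (subst has_sum_reindex) (use assms(2) in \<open>auto simp: o_def inj_on_def\<close>)
  moreover have "range int \<inter> range (\<lambda>n. - 1 - int n) = {}" by auto
  moreover have "k \<in> range int \<union> range (\<lambda>n. - 1 - int n)" for k
    by (cases k) (auto simp: image_iff)
  then have "range int \<union> range (\<lambda>n. - 1 - int n) = UNIV" by blast
  ultimately show ?thesis using has_sum_Un_disjoint[of f "range int" a _ b] by metis
qed

text \<open>This is cosh(lam (x - 1/2)) / sinh(lam/2), and \<open>sinh_profile\<close> is sinh(lam
  (1/2 - x)) / sinh(lam/2). Both are smooth on the whole line, so two-sided derivatives are
  available at 0 and 1, where p has its corners.\<close>

definition cosh_profile :: "real \<Rightarrow> real \<Rightarrow> real" where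
  "cosh_profile lam x = (exp (- lam * x) + exp (- lam * (1 - x))) / (1 - exp (- lam))"

definition sinh_profile :: "real \<Rightarrow> real \<Rightarrow> real" where
  "sinh_profile lam x = (exp (- lam * x) - exp (- lam * (1 - x))) / (1 - exp (- lam))"

lemma has_sum_exp_geometric:
  assumes "lam > (0::real)"
  shows "((\<lambda>n::nat. c * exp (- lam * (y + real n))) has_sum (c * (exp (- lam * y) / (1 - exp (- lam))))) UNIV"
proof (intro has_sum_cmult_right)
  have "(\<lambda>n. exp (- lam * y) * exp (- lam) ^ n) sums (exp (- lam * y) * (1 / (1 - exp (- lam))))"
    using assms by (intro sums_mult geometric_sums) auto
  moreover have "exp (- lam * y) * exp (- lam) ^ n = exp (- lam * (y + real n))" for n
    by (simp add: ring_distribs flip: exp_of_nat_mult exp_add)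
  ultimately have "(\<lambda>n. exp (- lam * (y + real n))) sums (exp (- lam * y) / (1 - exp (- lam)))"
    by simp
  then show "((\<lambda>n. exp (- lam * (y + real n))) has_sum (exp (- lam * y) / (1 - exp (- lam)))) UNIV"
    by (intro sums_nonneg_imp_has_sum) auto
qed

lemma has_sum_exp_abs:
  assumes "lam > 0" "0 \<le> x" "x \<le> 1"
  shows "((\<lambda>m::int. exp (- lam * \<bar>x + of_int m\<bar>)) has_sum cosh_profile lam x) UNIV"
proof -
  \<comment> \<open>For the summand with index -1 - n the argument is at most 0, since x is at most
    1; the absolute value then opens to 1 - x + n.\<close>
  have *: "x + (- 1 - real n) = - (1 - x + real n)" for n by simp
  show ?thesis
    using has_sum_int[of "\<lambda>m. exp (- lam * \<bar>x + of_int m\<bar>)"] assms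
      has_sum_exp_geometric[of lam 1 x] has_sum_exp_geometric[of lam 1 "1 - x"]
    by (simp add: cosh_profile_def add_divide_distrib * del: minus_add_distrib)
qed

text \<open>The end points are excluded: at x = 0 the series sums to 0 because the term m = 0 has
  sign 0, while \<open>sinh_profile lam 0\<close> is 1. Up to the factor -lam, the series takes the
  mean of the two slopes at the corner and the profile takes the right-hand one.\<close>

lemma has_sum_sgn_exp_abs:
  assumes "lam > 0" "0 < x" "x < 1"
  shows "((\<lambda>m::int. sgn (x + of_int m) * exp (- lam * \<bar>x + of_int m\<bar>)) has_sum sinh_profile lam x) UNIV"
proof -
  have *: "x + (- 1 - real n) = - (1 - x + real n)" for n by simp
  have **: "sgn (- (1 - x + real n)) = -1" "sgn (x + real n) = 1" for n using assms by (auto simp: sgn_if)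
  show ?thesis
    using has_sum_int[of "\<lambda>m. sgn (x + of_int m) * exp (- lam * \<bar>x + of_int m\<bar>)"
      "exp (- (lam * x)) / (1 - exp (- lam))" "- (exp (- (lam * (1 - x))) / (1 - exp (- lam)))"] assms
      has_sum_exp_geometric[of lam 1 x] has_sum_exp_geometric[of lam "-1" "1 - x"]
    by (simp add: sinh_profile_def diff_divide_distrib * ** del: minus_add_distrib)
qed

lemma p_fun_eq_cosh_profile:
  assumes "lam > 0" "0 \<le> x" "x \<le> 1"
  shows "p_fun lam x = - (2 / lam) + cosh_profile lam x"
  using infsumI[OF has_sum_exp_abs[OF assms]] by (simp add: p_fun_def)

lemma p_fun_periodic: "p_fun lam (x + of_int k) = p_fun lam x"
proof -
  have "(\<Sum>\<^sub>\<infinity>m::int. exp (- lam * \<bar>x + of_int m\<bar>)) = (\<Sum>\<^sub>\<infinity>m::int. exp (- lam * \<bar>x + of_int (m + k)\<bar>))"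
    by (rule infsum_reindex_bij_betw[symmetric, of "\<lambda>m. m + k" UNIV UNIV])
       (rule bij_betwI[of _ _ _ "\<lambda>m. m - k"]; simp)
  then show ?thesis by (simp add: p_fun_def algebra_simps)
qed

lemma cosh_profile_pos: "lam > 0 \<Longrightarrow> cosh_profile lam x > 0"
  by (auto simp: cosh_profile_def intro!: divide_pos_pos add_pos_pos)

lemma has_real_derivative_cosh_profile:
  "(cosh_profile lam has_real_derivative - lam * sinh_profile lam x) (at x)"
  unfolding cosh_profile_def[abs_def] sinh_profile_def times_divide_eq_right
  by (rule DERIV_cdivide) (auto intro!: derivative_eq_intros simp: algebra_simps)

lemma has_real_derivative_sinh_profile:
  "(sinh_profile lam has_real_derivative - lam * cosh_profile lam x) (at x)"
  unfolding cosh_profile_def sinh_profile_def[abs_def] times_divide_eq_right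
  by (rule DERIV_cdivide) (auto intro!: derivative_eq_intros simp: algebra_simps)

lemma has_real_derivative_neg_sinh_profile:
  "((\<lambda>x. - lam * sinh_profile lam x) has_real_derivative lam\<^sup>2 * cosh_profile lam x) (at x)"
  using DERIV_cmult[OF has_real_derivative_sinh_profile, of "-lam" lam x]
  by (simp add: power2_eq_square mult_ac)

lemma sinh_profile_0 [simp]: "lam > 0 \<Longrightarrow> sinh_profile lam 0 = 1"
  by (simp add: sinh_profile_def)

lemma sinh_profile_strict_decreasing:
  assumes "lam > 0" "x < y" shows "sinh_profile lam x > sinh_profile lam y"
  using DERIV_neg_imp_decreasing[OF assms(2), of "sinh_profile lam"]
    has_real_derivative_sinh_profile[of lam] cosh_profile_pos[OF assms(1)] assms(1)
  by (metis mult_neg_pos neg_less_0_iff_less)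

text \<open>Points of \<open>D\<close> count twice and points of \<open>E\<close> three times. One
  more zero would force \<open>T\<close> to vanish identically, but \<open>T\<close> agrees with the
  positive profile on \<open>Z\<close>, which cannot be empty in that case.\<close>

lemma cosh_profile_trig_zero_count:
  assumes lam: "lam > 0" and T: "real_trig_poly N T"
    and T1: "\<And>x. (T has_real_derivative T1 x) (at x)"
    and T2: "\<And>x. (T1 has_real_derivative T2 x) (at x)"
    and Z: "finite Z" "Z \<subseteq> {0..1}" "\<And>z. z \<in> Z \<Longrightarrow> T z = cosh_profile lam z"
    and D: "D \<subseteq> Z" "D \<subseteq> {0<..<1}" "\<And>z. z \<in> D \<Longrightarrow> T1 z = - lam * sinh_profile lam z"
    and E: "E \<subseteq> D" "\<And>z. z \<in> E \<Longrightarrow> T2 z = lam\<^sup>2 * cosh_profile lam z"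
  shows "card Z + card D + card E \<le> 2 * N + 2"
proof (rule ccontr)
  assume "\<not> ?thesis"
  then have card: "card Z + card D + card E \<ge> 2 * N + 3" by simp
  note q2 = has_real_derivative_neg_sinh_profile
  have T0: "T z = 0" for z
  proof (rule exp_trig_zero_count[OF lam T refl _ _ has_real_derivative_cosh_profile q2 Z(1,2) _ D(1,2) _ E(1) _ card])
    show "((\<lambda>x. T x - cosh_profile lam x) has_real_derivative T1 x - - lam * sinh_profile lam x) (at x)" for x
      by (intro DERIV_diff T1 has_real_derivative_cosh_profile)
    show "((\<lambda>x. T1 x - - lam * sinh_profile lam x) has_real_derivative T2 x - lam\<^sup>2 * cosh_profile lam x) (at x)" for x
      by (intro DERIV_diff T2 q2)
  qed (simp_all add: Z(3) D(3) E(2))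
  have "Z \<noteq> {}"
  proof
    assume "Z = {}"
    then show False using D(1) E(1) card by auto
  qed
  then obtain z where "z \<in> Z" by blast
  then show False using Z(3)[of z] T0[of z] cosh_profile_pos[OF lam, of z] by simp
qed

text \<open>The zeros 0 and 1 and the N double zeros in \<open>D\<close> exhaust the count 2N + 2.
  Hence there are no others in the interval, none in \<open>D\<close> is triple, and the sign just
  to the right of 0 persists.\<close>

lemma cosh_profile_le_interpolant:
  assumes lam: "lam > 0" and T: "real_trig_poly N T"
    and T1: "\<And>x. (T has_real_derivative T1 x) (at x)"
    and bd: "T 0 = cosh_profile lam 0" "T 1 = cosh_profile lam 1" "T1 0 = 0"
    and D: "finite D" "card D = N" "D \<subseteq> {0<..<1}"
    and inter: "\<And>z. z \<in> D \<Longrightarrow> T z = cosh_profile lam z" "\<And>z. z \<in> D \<Longrightarrow> T1 z = - lam * sinh_profile lam z"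
    and x: "0 \<le> x" "x \<le> 1"
  shows "cosh_profile lam x \<le> T x"
proof -
  obtain T1' where T1': "real_trig_poly N T1'" "\<And>x. (T has_real_derivative T1' x) (at x)"
    using real_trig_poly_derivative[OF T] by blast
  have "T1' = T1" using T1 T1'(2) DERIV_unique by blast
  with T1' obtain T2 where T2: "real_trig_poly N T2" "\<And>x. (T1 has_real_derivative T2 x) (at x)"
    using real_trig_poly_derivative by metis
  note q2 = has_real_derivative_neg_sinh_profile
  define f where "f x = T x - cosh_profile lam x" for x
  define f1 where "f1 x = T1 x - - lam * sinh_profile lam x" for x
  define f2 where "f2 x = T2 x - lam\<^sup>2 * cosh_profile lam x" for x
  have f1: "(f has_real_derivative f1 x) (at x)" for x
    unfolding f_def f1_def by (intro DERIV_diff T1 has_real_derivative_cosh_profile)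
  have f2: "(f1 has_real_derivative f2 x) (at x)" for x
    unfolding f1_def f2_def by (intro DERIV_diff T2 q2)
  \<comment> \<open>\<open>T\<close> is flat at 0 whereas the profile starts with slope -lam; the
    corner of p thus decides the sign.\<close>
  have "f1 0 > 0" using lam bd by (simp add: f1_def)
  from DERIV_pos_inc_right[OF f1 this] obtain d where
    d: "d > 0" "\<And>x. 0 < x \<Longrightarrow> x < d \<Longrightarrow> f x > 0" using bd by (auto simp: f_def)
  have nz: "0 \<notin> D" "1 \<notin> D" using D(3) by auto
  have zeros: "z \<in> D \<and> f2 z \<noteq> 0" if "0 < z" "z < 1" "f z = 0" for z
  proof (rule ccontr)
    assume *: "\<not> (z \<in> D \<and> f2 z \<noteq> 0)"
    \<comment> \<open>A zero outside \<open>D\<close> enlarges the set of zeros, and a node where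
      \<open>f2\<close> vanishes is a triple zero recorded in \<open>E\<close>. Either way the total
      rises from 2N + 2 to 2N + 3.\<close>
    define E where "E = (if z \<in> D then {z} else {})"
    have "card (insert z (insert 0 (insert 1 D))) + card D + card E \<le> 2 * N + 2"
      by (rule cosh_profile_trig_zero_count[OF lam T T1 T2(2)])
        (use that * D inter bd in \<open>auto simp: E_def f_def f2_def split: if_splits\<close>)
    moreover have "card (insert z (insert 0 (insert 1 D))) + card E = N + 3"
      using D nz that by (auto simp: E_def insert_absorb card_insert_if)
    ultimately show False using D(2) by simp
  qed
  have "f x \<ge> 0"
  proof (cases "x = 0")
    case False
    show ?thesis
      by (rule nonneg_of_double_zeros[OF f1 f2 d]) (use zeros inter x False in \<open>auto simp: f1_def\<close>)
  qed (use bd in \<open>simp add: f_def\<close>)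
  then show ?thesis by (simp add: f_def)
qed

text \<open>\<open>f\<close> first drops below its negative initial value and has to climb back to
  that level before it reaches 0 at \<open>a\<close>; Rolle applies between the two points at the
  level \<open>f 0\<close>.\<close>

lemma critical_point_of_dip:
  fixes f :: "real \<Rightarrow> real"
  assumes f1: "\<And>x. (f has_real_derivative f1 x) (at x)" and "f1 0 < 0" "f 0 < 0" "0 < a" "f a = 0"
  shows "\<exists>w. 0 < w \<and> w < a \<and> f1 w = 0"
proof -
  have cont: "isCont f y" for y using f1 by (rule DERIV_isCont)
  from DERIV_neg_dec_right[OF f1 \<open>f1 0 < 0\<close>] obtain d where
    d: "d > 0" "\<And>x. 0 < x \<Longrightarrow> x < d \<Longrightarrow> f x < f 0" by auto
  define b where "b = min (d/2) (a/2)"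
  have b: "0 < b" "b < a" "f b < f 0" using d \<open>0 < a\<close> by (auto simp: b_def)
  have "\<exists>c. b \<le> c \<and> c \<le> a \<and> f c = f 0"
    by (rule IVT) (use b assms cont in auto)
  then obtain c where c: "b \<le> c" "c \<le> a" "f c = f 0" by blast
  have "c \<noteq> a" using c assms by auto
  have "\<exists>w. 0 < w \<and> w < c \<and> (f has_real_derivative 0) (at w)"
    using b c f1 cont
    by (intro Rolle) (auto intro!: continuous_at_imp_continuous_on simp: real_differentiable_def)
  then show ?thesis
    using c \<open>c \<noteq> a\<close> f1 DERIV_unique by (metis less_le_trans)
qed

text \<open>The N + 1 double zeros in \<open>D\<close> exhaust the count, so the difference keeps
  its sign. Since no value is prescribed at 0, positivity there is proved by contradiction: a
  negative start creates a dip at each end of the interval, hence two more zeros of the derivative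
  than the count allows.\<close>

lemma interpolant_le_cosh_profile:
  assumes lam: "lam > 0" and T: "real_trig_poly N T"
    and T1: "\<And>x. (T has_real_derivative T1 x) (at x)"
    and bd: "T1 0 = 0"
    and D: "finite D" "card D = N + 1" "D \<subseteq> {0<..<1}"
    and inter: "\<And>z. z \<in> D \<Longrightarrow> T z = cosh_profile lam z" "\<And>z. z \<in> D \<Longrightarrow> T1 z = - lam * sinh_profile lam z"
    and x: "0 \<le> x" "x \<le> 1"
  shows "T x \<le> cosh_profile lam x"
proof -
  obtain T1' where T1': "real_trig_poly N T1'" "\<And>x. (T has_real_derivative T1' x) (at x)"
    using real_trig_poly_derivative[OF T] by blast
  have "T1' = T1" using T1 T1'(2) DERIV_unique by blast
  with T1' have T1p: "real_trig_poly N T1" by simp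
  obtain T2 where T2: "real_trig_poly N T2" "\<And>x. (T1 has_real_derivative T2 x) (at x)"
    using real_trig_poly_derivative[OF T1p] by metis
  obtain T3 where T3: "real_trig_poly N T3" "\<And>x. (T2 has_real_derivative T3 x) (at x)"
    using real_trig_poly_derivative[OF T2(1)] by metis
  note q2 = has_real_derivative_neg_sinh_profile
  have q3: "((\<lambda>x. lam\<^sup>2 * cosh_profile lam x) has_real_derivative lam\<^sup>2 * (- lam * sinh_profile lam x)) (at x)" for x
    by (intro DERIV_cmult has_real_derivative_cosh_profile)
  define f where "f x = cosh_profile lam x - T x" for x
  define f1 where "f1 x = - lam * sinh_profile lam x - T1 x" for x
  define f2 where "f2 x = lam\<^sup>2 * cosh_profile lam x - T2 x" for x
  have f1: "(f has_real_derivative f1 x) (at x)" for x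
    unfolding f_def f1_def by (intro DERIV_diff T1 has_real_derivative_cosh_profile)
  have f2: "(f1 has_real_derivative f2 x) (at x)" for x
    unfolding f1_def f2_def by (intro DERIV_diff T2 q2)
  have cont: "isCont f y" for y using f1 by (rule DERIV_isCont)
  have zeros: "z \<in> D \<and> f2 z \<noteq> 0" if "0 \<le> z" "z \<le> 1" "f z = 0" for z
  proof (rule ccontr)
    assume *: "\<not> (z \<in> D \<and> f2 z \<noteq> 0)"
    define E where "E = (if z \<in> D then {z} else {})"
    have "T z = cosh_profile lam z" using that by (simp add: f_def)
    then have "card (insert z D) + card D + card E \<le> 2 * N + 2"
      by (intro cosh_profile_trig_zero_count[OF lam T T1 T2(2)])
        (use that(1,2) * D inter in \<open>auto simp: E_def f_def f2_def split: if_splits\<close>)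
    moreover have "card (insert z D) + card E = N + 2"
      using D that by (auto simp: E_def insert_absorb card_insert_if)
    ultimately show False using D(2) by simp
  qed
  have f0: "f 0 > 0"
  proof (rule ccontr)
    assume "\<not> f 0 > 0"
    then have neg: "f 0 < 0" using zeros[of 0] D(3) by force
    have "f1 0 < 0" using lam bd by (simp add: f1_def)
    define a where "a = Min D"
    define b where "b = Max D"
    have "D \<noteq> {}" using D by auto
    then have a: "a \<in> D" "\<And>z. z \<in> D \<Longrightarrow> a \<le> z" and b: "b \<in> D" "\<And>z. z \<in> D \<Longrightarrow> z \<le> b"
      using D(1) by (auto simp: a_def b_def)
    have ab: "0 < a" "a < 1" "0 < b" "b < 1" using a b D(3) by auto
    have fab: "f a = 0" "f b = 0" using inter a b by (simp_all add: f_def)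
    obtain w where w: "0 < w" "w < a" "f1 w = 0"
      using critical_point_of_dip[OF f1 \<open>f1 0 < 0\<close> neg ab(1) fab(1)] by blast
    have "T 1 = T 0" "T1 1 = T1 0"
      using real_trig_poly_periodic[OF T, of 0 1] real_trig_poly_periodic[OF T1p, of 0 1] by simp_all
    then have f_1: "f 1 = f 0" "f1 1 > 0"
      using lam bd by (simp_all add: f_def f1_def cosh_profile_def sinh_profile_def divide_simps mult_less_0_iff)
    \<comment> \<open>Reflection carries the dip argument from 0 to the end point 1, where by
      periodicity of \<open>T\<close> the difference has the same value and the opposite
      slope.\<close>
    have "((\<lambda>x. f (1 - x)) has_real_derivative - f1 (1 - x)) (at x)" for x
    proof -
      have "((\<lambda>x. 1 - x) has_real_derivative - 1) (at x)" by (auto intro!: derivative_eq_intros)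
      from DERIV_chain2[OF f1 this] show ?thesis by simp
    qed
    then obtain w' where w': "0 < w'" "w' < 1 - b" "f1 (1 - w') = 0"
      using critical_point_of_dip[of "\<lambda>x. f (1 - x)" "\<lambda>x. - f1 (1 - x)" "1 - b"] f_1 neg ab fab by auto
    obtain Z where Z: "finite Z" "card Z = N" "Z \<inter> D = {}"
      "\<And>z. z \<in> Z \<Longrightarrow> f1 z = 0 \<and> (\<exists>a\<in>D. a < z) \<and> (\<exists>b\<in>D. z < b)"
      using Rolle_finite_set[OF D(1) _ f1, where k = 0] inter D(2) by (auto simp: f_def)
    have Zsub: "Z \<subseteq> {a<..<b}"
    proof
      fix z assume "z \<in> Z"
      then obtain u v where "u \<in> D" "u < z" "v \<in> D" "z < v" using Z(4) by blast
      moreover have "a \<le> u" "v \<le> b" using a b calculation by auto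
      ultimately show "z \<in> {a<..<b}" by auto
    qed
    \<comment> \<open>The N + 1 nodes, the N points between them and one critical point from each
      end gap make 2N + 3 zeros of \<open>f1\<close>.\<close>
    define Y where "Y = insert w (insert (1 - w') (Z \<union> D))"
    have "w \<notin> Z \<union> D" using a(2)[of w] w Zsub by auto
    moreover have "1 - w' \<notin> Z \<union> D" using b(2)[of "1 - w'"] w' Zsub by auto
    moreover have "w < 1 - w'" using a(2)[OF b(1)] w w' by linarith
    ultimately have "card Y = 2 * N + 3"
      using Z D by (simp add: Y_def card_Un_disjoint)
    moreover have "Y \<subseteq> {0..1}" using w w' Zsub D ab by (force simp: Y_def)
    moreover have Y0: "f1 z = 0" if "z \<in> Y" for z
      using that w w' Z inter by (auto simp: Y_def f1_def)
    ultimately have card: "card Y + card ({}::real set) + card ({}::real set) \<ge> 2 * N + 3"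
      and Y: "Y \<subseteq> {0..1}" "\<And>z. z \<in> Y \<Longrightarrow> f1 z = 0" by auto
    \<comment> \<open>The derivative of the profile also satisfies q'' = lam^2 q, so the zero count
      applies one derivative higher, with all zeros counted as simple. Then
      \<open>sinh_profile\<close> would agree at \<open>w\<close> and \<open>a\<close>, although it
      is strictly decreasing.\<close>
    have T10: "T1 x = 0" for x
    proof (rule exp_trig_zero_count[OF lam T1p refl _ _ q2 q3 _ Y(1) _ _ _ _ _ _ card])
      show "((\<lambda>x. T1 x - - lam * sinh_profile lam x) has_real_derivative T2 x - lam\<^sup>2 * cosh_profile lam x) (at x)" for x
        by (intro DERIV_diff T2 q2)
      show "((\<lambda>x. T2 x - lam\<^sup>2 * cosh_profile lam x) has_real_derivative
             T3 x - lam\<^sup>2 * (- lam * sinh_profile lam x)) (at x)" for x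
        by (intro DERIV_diff T3 q3)
      show "finite Y" using Z D by (simp add: Y_def)
      show "T1 z - - lam * sinh_profile lam z = 0" if "z \<in> Y" for z
        using Y(2)[OF that] by (simp add: f1_def)
    qed simp_all
    have "f1 w = f1 a" using w Y0[of a] a by (simp add: Y_def)
    then have "sinh_profile lam w = sinh_profile lam a" using lam by (simp add: f1_def T10)
    then show False using sinh_profile_strict_decreasing[OF lam w(2)] by simp
  qed
  obtain d where d: "d > 0" "\<And>x. 0 < x \<Longrightarrow> x < d \<Longrightarrow> f x > 0"
  proof -
    obtain d where d: "d > 0" "\<And>y. \<bar>y - 0\<bar> < d \<Longrightarrow> \<bar>f y - f 0\<bar> < f 0"
      using cont[of 0] f0 unfolding continuous_at_eps_delta dist_real_def by blast
    show thesis
    proof (rule that[OF d(1)])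
      fix x assume "0 < x" "x < d"
      then show "f x > 0" using d(2)[of x] by (auto simp: abs_less_iff)
    qed
  qed
  have "f x \<ge> 0"
  proof (cases "x = 0")
    case False
    show ?thesis
      by (rule nonneg_of_double_zeros[OF f1 f2 d]) (use zeros inter x False in \<open>auto simp: f1_def\<close>)
  qed (use f0 in simp)
  then show ?thesis by (simp add: f_def)
qed

section \<open>Quadrature at equispaced nodes and the case of equality\<close>

lemma circle_integral_unit_exp:
  "set_integrable lborel {0..<1} (\<lambda>x. c * unit_exp (of_int n * x))"
  "circle_integral (\<lambda>x. c * unit_exp (of_int n * x)) = (if n = 0 then c else 0)"
proof -
  have ico: "{0..<1} = {0..1} - {1::real}" by auto
  have cont: "continuous_on {0..1} (\<lambda>x. c * unit_exp (of_int n * x))" by (intro continuous_intros)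
  have int: "set_integrable lborel {0..1} (\<lambda>x. c * unit_exp (of_int n * x))"
    using cont by (rule borel_integrable_atLeastAtMost')
  then show "set_integrable lborel {0..<1} (\<lambda>x. c * unit_exp (of_int n * x))"
    by (rule set_integrable_subset) auto
  have eq: "circle_integral (\<lambda>x. c * unit_exp (of_int n * x)) = (LBINT x:{0..1}. c * unit_exp (of_int n * x))"
    unfolding circle_integral_def ico
    by (rule set_integral_discrete_difference[where X = "{1}"]) auto
  show "circle_integral (\<lambda>x. c * unit_exp (of_int n * x)) = (if n = 0 then c else 0)"
  proof (cases "n = 0")
    case True
    then show ?thesis by (simp add: circle_integral_def set_lebesgue_integral_def)
  next
    case False
    define F where "F x = c / (2 * of_real pi * \<i> * of_int n) * unit_exp (of_int n * x)" for x
    have F: "(F has_vector_derivative c * unit_exp (of_int n * x)) (at x within {0..1})" for x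
      unfolding F_def
      by (rule has_vector_derivative_eq_rhs, rule has_vector_derivative_mult_right, rule has_vector_derivative_unit_exp)
        (use False in \<open>simp add: field_simps\<close>)
    have "(LBINT x:{0..1}. c * unit_exp (of_int n * x)) = F 1 - F 0"
      unfolding set_lebesgue_integral_def by (rule integral_FTC_atLeastAtMost[OF _ F cont]) auto
    also have "\<dots> = 0" using unit_exp_of_int[of n] by (simp add: F_def)
    finally show ?thesis using False eq by simp
  qed
qed

lemma circle_integral_trig_sum:
  "circle_integral (\<lambda>x. \<Sum>n = - int N..int N. c n * unit_exp (of_int n * x)) = c 0"
proof -
  have "circle_integral (\<lambda>x. \<Sum>n = - int N..int N. c n * unit_exp (of_int n * x)) =
        (\<Sum>n = - int N..int N. circle_integral (\<lambda>x. c n * unit_exp (of_int n * x)))"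
    using circle_integral_unit_exp(1)
    unfolding circle_integral_def set_lebesgue_integral_def set_integrable_def scaleR_sum_right
    by (intro Bochner_Integration.integral_sum) auto
  also have "\<dots> = c 0" by (simp add: circle_integral_unit_exp)
  finally show ?thesis .
qed

lemma circle_integral_of_real:
  "circle_integral (\<lambda>x. complex_of_real (f x)) = of_real (circle_integral f)"
  unfolding circle_integral_def by (rule set_integral_complex_of_real)

lemma sum_unit_exp_eq_0:
  assumes "K > 0" "\<not> int K dvd n"
  shows "(\<Sum>j<K. unit_exp (of_int n * (real j / real K))) = 0"
proof -
  note K = \<open>K > 0\<close>
  define w where "w = unit_exp (of_int n / real K)"
  have "w \<noteq> 1"
  proof
    assume "w = 1"
    then obtain m where "of_int n / real K = of_int m" by (auto simp: w_def unit_exp_eq_1_iff elim: Ints_cases)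
    then have "real_of_int n = of_int (int K * m)" using K by (simp add: field_simps)
    then have "n = int K * m" by linarith
    then show False using assms by simp
  qed
  moreover have "w ^ K = 1"
    using K by (simp add: w_def flip: unit_exp_of_nat_mult)
  moreover have "(\<Sum>j<K. unit_exp (of_int n * (real j / real K))) = (\<Sum>j<K. w ^ j)"
    unfolding w_def unit_exp_of_nat_mult[symmetric] by (simp add: mult_ac)
  ultimately show ?thesis by (simp add: sum_gp_strict)
qed

text \<open>The frequency n sums to 0 over the nodes unless N + 1 divides n, and in the range from
  -N to N this leaves only n = 0. The offset \<open>s\<close> merely multiplies each frequency by a
  constant.\<close>

lemma circle_integral_eq_quadrature:
  assumes "real_trig_poly N f"
  shows "circle_integral f = (\<Sum>j\<le>N. f ((real j + s) / real (N + 1))) / real (N + 1)"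
proof -
  obtain c where c: "\<And>x. of_real (f x) = (\<Sum>n = - int N..int N. c n * unit_exp (of_int n * x))"
    using assms by (auto simp: real_trig_poly_def)
  define K where "K = N + 1"
  have "complex_of_real (circle_integral f) = c 0"
    unfolding circle_integral_of_real[symmetric] c by (rule circle_integral_trig_sum)
  moreover have "complex_of_real (\<Sum>j\<le>N. f ((real j + s) / real (N + 1))) = of_nat K * c 0"
  proof -
    have "complex_of_real (\<Sum>j\<le>N. f ((real j + s) / real (N + 1))) =
      (\<Sum>j<K. \<Sum>n = - int N..int N. c n * unit_exp (of_int n * ((real j + s) / real K)))"
      by (simp add: c K_def lessThan_Suc_atMost)
    also have "\<dots> = (\<Sum>n = - int N..int N. \<Sum>j<K. c n * unit_exp (of_int n * ((real j + s) / real K)))"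
      by (rule sum.swap)
    also have "\<dots> = (\<Sum>n = - int N..int N. if n = 0 then of_nat K * c 0 else 0)"
    proof (rule sum.cong)
      fix n assume n: "n \<in> {- int N..int N}"
      have "(\<Sum>j<K. c n * unit_exp (of_int n * ((real j + s) / real K))) =
            c n * unit_exp (of_int n * (s / real K)) * (\<Sum>j<K. unit_exp (of_int n * (real j / real K)))"
        unfolding sum_distrib_left
        by (intro sum.cong refl) (simp add: add_divide_distrib ring_distribs unit_exp_add)
      moreover have "\<not> int K dvd n" if "n \<noteq> 0"
        using zdvd_imp_le[of "int K" "\<bar>n\<bar>"] n that by (auto simp: K_def)
      ultimately show "(\<Sum>j<K. c n * unit_exp (of_int n * ((real j + s) / real K))) =
          (if n = 0 then of_nat K * c 0 else 0)"
        using sum_unit_exp_eq_0[of K n] by (auto simp: K_def)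
    qed simp
    finally show ?thesis by simp
  qed
  ultimately have "complex_of_real (\<Sum>j\<le>N. f ((real j + s) / real (N + 1))) =
     of_real (real K * circle_integral f)" by simp
  then have "(\<Sum>j\<le>N. f ((real j + s) / real (N + 1))) = real K * circle_integral f"
    unfolding of_real_eq_iff .
  then show ?thesis by (simp add: K_def)
qed

lemma nonneg_at_nodes_imp_circle_integral_nonneg:
  assumes "real_trig_poly N f" "\<And>j. j \<le> N \<Longrightarrow> f ((real j + s) / real (N + 1)) \<ge> 0"
  shows "circle_integral f \<ge> 0"
    and "circle_integral f = 0 \<Longrightarrow> j \<le> N \<Longrightarrow> f ((real j + s) / real (N + 1)) = 0"
proof -
  show "circle_integral f \<ge> 0"
    unfolding circle_integral_eq_quadrature[OF assms(1), of s]
    using assms(2) by (intro divide_nonneg_nonneg sum_nonneg) auto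
  assume "circle_integral f = 0" "j \<le> N"
  then have "(\<Sum>j\<le>N. f ((real j + s) / real (N + 1))) = 0"
    unfolding circle_integral_eq_quadrature[OF assms(1), of s] by auto
  then show "f ((real j + s) / real (N + 1)) = 0"
    using assms(2) \<open>j \<le> N\<close> by (subst (asm) sum_nonneg_eq_0_iff) auto
qed

text \<open>The nodes together with the translate of node 0 by one period give N + 2 zeros of
  \<open>f\<close>, hence N + 1 zeros of \<open>f1\<close> strictly between them. With the N nodes
  from \<open>1\<close> that is 2N + 1, too many for degree N. Node 0 is left out of the derivative
  condition because for s = 0 it is the corner of p.\<close>

lemma real_trig_poly_eq_0_of_double_zeros:
  assumes f: "real_trig_poly N f" and f1: "\<And>x. (f has_real_derivative f1 x) (at x)"
    and 0: "\<And>j. j \<le> N \<Longrightarrow> f ((real j + s) / real (N + 1)) = 0"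
    and 1: "\<And>j. 1 \<le> j \<Longrightarrow> j \<le> N \<Longrightarrow> f1 ((real j + s) / real (N + 1)) = 0"
  shows "f x = 0"
proof -
  define nd where "nd j = (real j + s) / real (N + 1)" for j
  have nd_less: "nd i < nd j \<longleftrightarrow> i < j" for i j by (simp add: nd_def divide_less_cancel)
  then have inj: "inj nd" by (metis injI linorder_neq_iff)
  obtain g where g: "real_trig_poly N g" "\<And>x. (f has_real_derivative g x) (at x)"
    using real_trig_poly_derivative[OF f] by blast
  then have g_eq: "g = f1" using f1 DERIV_unique by blast
  have nd_end: "nd (N + 1) = nd 0 + 1" by (simp add: nd_def field_simps)
  have nd0: "f (nd j) = 0" if "j \<le> N + 1" for j
  proof (cases "j = N + 1")
    case True
    then show ?thesis using real_trig_poly_periodic[OF f, of "nd 0" 1] nd_end 0[of 0] by (simp add: nd_def)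
  qed (use 0[of j] that in \<open>simp add: nd_def\<close>)
  have card_nd: "card (nd ` A) = card A" for A using inj by (intro card_image) (auto simp: inj_on_def)
  have "f z = 0" if "z \<in> nd ` {..N + 1}" for z using that nd0 by auto
  then obtain Z where Z: "finite Z" "card Z = N + 1" "Z \<inter> nd ` {..N + 1} = {}"
    "\<And>z. z \<in> Z \<Longrightarrow> f1 z = 0 \<and> (\<exists>a\<in>nd ` {..N + 1}. a < z) \<and> (\<exists>b\<in>nd ` {..N + 1}. z < b)"
    using Rolle_finite_set[OF _ _ f1, of "nd ` {..N + 1}" 0] card_nd[of "{..N + 1}"] by auto
  have sub: "Z \<union> nd ` {1..N} \<subseteq> {nd 0..<nd 0 + 1}"
  proof
    fix z assume "z \<in> Z \<union> nd ` {1..N}"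
    then obtain i j where "i \<le> N + 1" "j \<le> N + 1" "nd i \<le> z" "z < nd j"
    proof
      assume "z \<in> nd ` {1..N}"
      then obtain k where "z = nd k" "k \<le> N" by auto
      then show thesis by (intro that[of k "k+1"]) (auto simp: nd_less)
    next
      assume "z \<in> Z"
      then show thesis using Z(4)[of z] that by (auto simp: less_imp_le)
    qed
    moreover have "nd 0 \<le> nd i" "nd j \<le> nd (N + 1)"
      using calculation nd_less[of i 0] nd_less[of "N+1" j] by (auto simp: not_less[symmetric] simp del: not_less)
    ultimately show "z \<in> {nd 0..<nd 0 + 1}" using nd_end by simp
  qed
  have disj: "Z \<inter> nd ` {1..N} = {}" using Z(3) by auto
  have "f1 y = 0" for y
  proof (rule real_trig_poly_zero[OF g(1)[unfolded g_eq] _ sub])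
    show "finite (Z \<union> nd ` {1..N})" using Z by simp
    show "f1 z = 0" if "z \<in> Z \<union> nd ` {1..N}" for z
      using that Z(4) 1 by (auto simp: nd_def)
    show "2 * N + 1 \<le> card (Z \<union> nd ` {1..N})"
      using Z disj card_nd[of "{1..N}"] by (subst card_Un_disjoint) auto
  qed
  then have "f x = f (nd 0)"
    using f1 DERIV_isconst_all[of f x "nd 0"] by simp
  then show ?thesis using nd0[of 0] by simp
qed

section \<open>Fourier transforms of the interpolation kernels\<close>

lemma Si_0 [simp]: "Si 0 = 0"
  using Si_neg[of 0] by simp

lemma has_bochner_integral_sinc_squared: "has_bochner_integral lborel (\<lambda>x. (sinc x)\<^sup>2) pi"
proof -
  \<comment> \<open>Integration by parts, with sin(2x)/x integrated to \<open>Si (2 * x)\<close>;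
    the boundary term sin^2(x)/x is written with \<open>sinc\<close> to make it continuous at
    0.\<close>
  define F where "F x = Si (2 * x) - sin x * sinc x" for x
  have F: "(F has_real_derivative (sinc x)\<^sup>2) (at x)" if "x > 0" for x
  proof -
    have "((\<lambda>x. Si (2 * x) - sin x * (sin x / x)) has_real_derivative
       sinc (2 * x) * 2 - (cos x * (sin x / x) + (cos x * x - sin x) / (x * x) * sin x)) (at x)"
      using that by (auto intro!: derivative_eq_intros DERIV_chain2[OF DERIV_Si] simp: field_simps)
    moreover have "sinc (2 * x) * 2 - (cos x * (sin x / x) + (cos x * x - sin x) / (x * x) * sin x) = (sinc x)\<^sup>2"
      using that sin_double[of x] by (simp add: field_simps power2_eq_square)
    ultimately have "((\<lambda>x. Si (2 * x) - sin x * (sin x / x)) has_real_derivative (sinc x)\<^sup>2) (at x)"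
      by simp
    then show ?thesis
      by (rule has_field_derivative_transform_within_open[of _ _ _ "{0<..}"]) (use that in \<open>auto simp: F_def\<close>)
  qed
  have isF: "isCont F 0"
    unfolding F_def by (intro continuous_intros isCont_Si isCont_sinc isCont_o2[OF _ isCont_Si])
  have 0: "(F \<longlongrightarrow> 0) (at_right 0)"
  proof -
    have "F 0 = 0" by (simp add: F_def)
    then show ?thesis using isF unfolding isCont_def by (metis filterlim_at_split)
  qed
  have "((\<lambda>x. Si (2 * x)) \<longlongrightarrow> pi / 2) at_top"
    by (rule filterlim_compose[OF Si_at_top]) (auto intro!: filterlim_tendsto_pos_mult_at_top filterlim_ident)
  moreover have "((\<lambda>x. sin x * sinc x) \<longlongrightarrow> 0) at_top"
  proof (rule Lim_null_comparison)
    show "\<forall>\<^sub>F x in at_top. norm (sin x * sinc x) \<le> 1 / x"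
      using eventually_gt_at_top[of 0]
    proof eventually_elim
      case (elim x)
      have "\<bar>sin x\<bar> * \<bar>sin x\<bar> \<le> 1 * 1" by (intro mult_mono) auto
      then show ?case using elim by (auto simp: abs_mult field_simps)
    qed
    show "((\<lambda>x::real. 1 / x) \<longlongrightarrow> 0) at_top" by real_asymp
  qed
  ultimately have 1: "(F \<longlongrightarrow> pi / 2) at_top"
    unfolding F_def using tendsto_diff by fastforce
  have *: "set_integrable lborel (einterval 0 \<infinity>) (\<lambda>x. (sinc x)\<^sup>2)"
       "(LBINT x=0..\<infinity>. (sinc x)\<^sup>2) = pi / 2 - 0"
    by (rule interval_integral_FTC_nonneg[of 0 \<infinity> F]; 
        use F 0 1 isCont_sinc in \<open>auto simp: ereal_tendsto_simps zero_ereal_def intro!: continuous_intros\<close>)+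
  have "has_bochner_integral lborel (\<lambda>x. indicator {0<..} x *\<^sub>R (sinc x)\<^sup>2) (pi / 2)"
    using * by (simp add: interval_lebesgue_integral_def set_lebesgue_integral_def set_integrable_def
         has_bochner_integral_iff einterval_def zero_ereal_def greaterThan_def)
  then have "has_bochner_integral lborel (\<lambda>x. indicator {0..} x *\<^sub>R (sinc x)\<^sup>2) (pi / 2)"
    by (rule has_bochner_integralI_AE) (use AE_lborel_singleton[of 0] in \<open>auto simp: indicator_def elim!: eventually_mono\<close>)
  from has_bochner_integral_even_function[OF this] show ?thesis
    by (simp del: sinc_neg) 
qed

lemma has_bochner_integral_sin_squared_scaled:
  "has_bochner_integral lborel (\<lambda>x. (sin (pi * a * x))\<^sup>2 / (pi * x)\<^sup>2) \<bar>a\<bar>"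
proof (cases "a = 0")
  case False
  have "has_bochner_integral lborel (\<lambda>x. (sinc (0 + pi * a * x))\<^sup>2) (pi /\<^sub>R \<bar>pi * a\<bar>)"
    using has_bochner_integral_sinc_squared False
    by (subst (asm) lborel_has_bochner_integral_real_affine_iff[of "pi * a" _ _ 0]) auto
  then have "has_bochner_integral lborel (\<lambda>x. a\<^sup>2 * (sinc (0 + pi * a * x))\<^sup>2) (a\<^sup>2 * (pi /\<^sub>R \<bar>pi * a\<bar>))"
    by (intro has_bochner_integral_mult_right) simp
  moreover have "a\<^sup>2 * (pi /\<^sub>R \<bar>pi * a\<bar>) = \<bar>a\<bar>"
    using False by (simp add: abs_mult field_simps power2_eq_square)
  ultimately have "has_bochner_integral lborel (\<lambda>x. a\<^sup>2 * (sinc (0 + pi * a * x))\<^sup>2) \<bar>a\<bar>" by simp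
  then show ?thesis
    by (rule has_bochner_integralI_AE)
       (use AE_lborel_singleton[of 0] False in \<open>auto simp: field_simps elim!: eventually_mono\<close>)
qed (simp add: has_bochner_integral_zero)

text \<open>sin^2(pi x) cos(2 pi t x) is a combination of squared sines with the scales t + 1, t - 1
  and t, each integrated by the preceding lemma, and the sine part of the exponential is odd. The
  value is the hat function max(1 - abs t, 0).\<close>

lemma has_bochner_integral_fejer:
  "has_bochner_integral lborel (\<lambda>x. complex_of_real ((sin (pi * x))\<^sup>2 / (pi * x)\<^sup>2) * unit_exp (- t * x))
     (of_real (\<bar>t + 1\<bar> / 2 + \<bar>t - 1\<bar> / 2 - \<bar>t\<bar>))"
proof -
  define f where "f x = (sin (pi * x))\<^sup>2 / (pi * x)\<^sup>2" for x
  have f: "has_bochner_integral lborel f 1"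
    using has_bochner_integral_sin_squared_scaled[of 1] by (simp add: f_def[abs_def])
  then have [measurable]: "f \<in> borel_measurable lborel" by (simp add: has_bochner_integral_iff integrable_iff_bounded)
  have "(sin (pi * x))\<^sup>2 * cos (2 * pi * t * x) =
      (sin (pi * (t + 1) * x))\<^sup>2 / 2 + (sin (pi * (t - 1) * x))\<^sup>2 / 2 - (sin (pi * t * x))\<^sup>2" for x
  proof -
    have c: "cos (2 * pi * t * x) = 1 - 2 * (sin (pi * t * x))\<^sup>2"
      using cos_double_sin[of "pi * t * x"] by (simp add: mult_ac)
    have "(sin (pi * (t + 1) * x))\<^sup>2 + (sin (pi * (t - 1) * x))\<^sup>2 =
       2 * ((sin (pi * t * x))\<^sup>2 * (cos (pi * x))\<^sup>2 + (cos (pi * t * x))\<^sup>2 * (sin (pi * x))\<^sup>2)"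
      by (simp add: ring_distribs sin_add sin_diff power2_eq_square algebra_simps)
    also have "\<dots> = 2 * (sin (pi * x))\<^sup>2 * cos (2 * pi * t * x) + 2 * (sin (pi * t * x))\<^sup>2"
      unfolding c cos_squared_eq by (simp add: algebra_simps)
    finally show ?thesis by simp
  qed
  then have fcos: "f x * cos (2 * pi * t * x) = (sin (pi * (t + 1) * x))\<^sup>2 / (pi * x)\<^sup>2 / 2 +
      (sin (pi * (t - 1) * x))\<^sup>2 / (pi * x)\<^sup>2 / 2 - (sin (pi * t * x))\<^sup>2 / (pi * x)\<^sup>2" for x
    by (simp add: f_def add_divide_distrib diff_divide_distrib times_divide_eq_left)
  have 1: "has_bochner_integral lborel (\<lambda>x. f x * cos (2 * pi * t * x)) (\<bar>t + 1\<bar> / 2 + \<bar>t - 1\<bar> / 2 - \<bar>t\<bar>)"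
    unfolding fcos
    by (intro has_bochner_integral_diff has_bochner_integral_add has_bochner_integral_divide
         has_bochner_integral_sin_squared_scaled)
  have int: "integrable lborel (\<lambda>x. f x * sin (2 * pi * t * x))"
  proof (rule Bochner_Integration.integrable_bound[of _ f])
    show "integrable lborel f" using f by (simp add: has_bochner_integral_iff)
    have "\<bar>f x\<bar> * \<bar>sin (2 * pi * t * x)\<bar> \<le> \<bar>f x\<bar> * 1" for x
      by (intro mult_left_mono) auto
    then show "AE x in lborel. norm (f x * sin (2 * pi * t * x)) \<le> norm (f x)"
      by (simp add: abs_mult)
  qed simp
  have "(LBINT x. f x * sin (2 * pi * t * x)) = \<bar>-1\<bar> *\<^sub>R (LBINT x. f (0 + -1 * x) * sin (2 * pi * t * (0 + -1 * x)))"
    by (rule lborel_integral_real_affine) simp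
  then have "(LBINT x. f x * sin (2 * pi * t * x)) = 0" by (simp add: f_def)
  with int have 2: "has_bochner_integral lborel (\<lambda>x. f x * sin (2 * pi * t * x)) 0"
    by (simp add: has_bochner_integral_iff)
  have "has_bochner_integral lborel
     (\<lambda>x. complex_of_real (f x * cos (2 * pi * t * x)) - \<i> * complex_of_real (f x * sin (2 * pi * t * x)))
     (of_real (\<bar>t + 1\<bar> / 2 + \<bar>t - 1\<bar> / 2 - \<bar>t\<bar>) - \<i> * of_real 0)"
    by (intro has_bochner_integral_diff has_bochner_integral_mult_right has_bochner_integral_of_real 1 2)
  moreover have "complex_of_real (f x) * unit_exp (- t * x) =
      complex_of_real (f x * cos (2 * pi * t * x)) - \<i> * complex_of_real (f x * sin (2 * pi * t * x))" for x
    by (simp add: unit_exp_eq_cis complex_eq_iff mult_ac)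
  ultimately show ?thesis by (simp add: f_def)
qed

lemma has_bochner_integral_lborel_shift:
  fixes f :: "real \<Rightarrow> 'a :: {banach, second_countable_topology}"
  assumes "has_bochner_integral lborel f I"
  shows "has_bochner_integral lborel (\<lambda>x. f (x - c)) I"
  using lborel_has_bochner_integral_real_affine_iff[of 1 f I "- c"] assms by simp

lemma sin_pi_diff_int_squared: "(sin (pi * (x - of_int k)))\<^sup>2 = (sin (pi * x))\<^sup>2"
proof -
  have "sin (pi * (x - of_int k)) = sin (pi * x) * cos (pi * of_int k)"
    using sin_integer_2pi sin_npi_int[of k] by (simp add: ring_distribs sin_diff mult_ac)
  then show ?thesis by (simp add: power_mult_distrib cos_npi_int)
qed

lemma has_bochner_integral_fejer_shift:
  assumes "\<bar>t\<bar> \<le> 1"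
  shows "has_bochner_integral lborel
     (\<lambda>x. complex_of_real ((sin (pi * x))\<^sup>2 / (pi * (x - of_int k))\<^sup>2) * unit_exp (- t * x))
     (of_real (1 - \<bar>t\<bar>) * unit_exp (- t * of_int k))"
proof -
  have "\<bar>t + 1\<bar> / 2 + \<bar>t - 1\<bar> / 2 - \<bar>t\<bar> = 1 - \<bar>t\<bar>" using assms by (auto simp: abs_if add_divide_distrib diff_divide_distrib)
  with has_bochner_integral_lborel_shift[OF has_bochner_integral_fejer[of t], of "of_int k"]
  have "has_bochner_integral lborel (\<lambda>x. complex_of_real ((sin (pi * (x - of_int k)))\<^sup>2 / (pi * (x - of_int k))\<^sup>2) *
     unit_exp (- t * (x - of_int k))) (of_real (1 - \<bar>t\<bar>))" by simp
  moreover have "unit_exp (- t * (x - of_int k)) * unit_exp (- t * of_int k) = unit_exp (- t * x)" for x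
    unfolding unit_exp_add[symmetric] by (simp add: algebra_simps)
  ultimately show ?thesis
    using has_bochner_integral_mult_left[of "unit_exp (- t * of_int k)" lborel
        "\<lambda>x. complex_of_real ((sin (pi * (x - of_int k)))\<^sup>2 / (pi * (x - of_int k))\<^sup>2) * unit_exp (- t * (x - of_int k))"]
    unfolding sin_pi_diff_int_squared mult.assoc by simp
qed

text \<open>The function \<open>sin\<^sup>2(\<pi>x) e(-tx) / x\<close> is not absolutely integrable, so its integrals are handled
  through an antiderivative \<open>G\<close>; \<open>G x - G (- x)\<close> is a combination of sine integrals.\<close>
lemma hilbert_antiderivative:
  assumes t: "\<bar>t\<bar> < 1"
  obtains G where
    "\<And>x. (G has_vector_derivative (complex_of_real ((sin (pi * x))\<^sup>2 / x) * unit_exp (- t * x))) (at x)"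
    "((\<lambda>x. G x - G (- x)) \<longlongrightarrow> - \<i> * of_real (pi / 2 * sgn t)) at_top"
proof -
  define h where "h x = complex_of_real ((sin (pi * x))\<^sup>2 / x) * unit_exp (- t * x)" for x
  \<comment> \<open>The value 0 that division by zero gives at x = 0 is also the limit there, so
    \<open>h\<close> is continuous.\<close>
  have h_eq: "h x = complex_of_real (pi * sin (pi * x) * sinc (pi * x)) * unit_exp (- t * x)" for x
    by (auto simp: h_def power2_eq_square)
  have "continuous_on UNIV sinc" by (auto intro: continuous_at_imp_continuous_on isCont_sinc)
  then have cont: "continuous_on S h" for S
    unfolding h_eq by (intro continuous_intros continuous_on_compose2[of UNIV sinc]) auto
  define G where "G x = (LBINT y=0..x. h y)" for x :: real
  have G: "(G has_vector_derivative h x) (at x)" for x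
  proof -
    have "(at x within {min 0 (x - 1)..max 0 (x + 1)}) = at x"
      by (intro at_within_interior) auto
    moreover have "min 0 (x - 1) \<le> x" "x \<le> max 0 (x + 1)" by auto
    ultimately show ?thesis
      using interval_integral_FTC2[of "min 0 (x - 1)" 0 "max 0 (x + 1)" h x] cont
      by (auto simp: G_def[abs_def] zero_ereal_def split del: if_split)
  qed
  \<comment> \<open>The derivative of G x - G (-x) is h x + h (-x), which is -2i sin^2(pi x) sin(2
    pi t x)/x. The product splits into sines of frequencies t, t + 1 and t - 1, whence three sine
    integrals.\<close>
  define D where "D x = - 2 * \<i> * complex_of_real (Si (2 * pi * t * x) / 2 -
      Si (2 * pi * (t + 1) * x) / 4 - Si (2 * pi * (t - 1) * x) / 4)" for x
  have D': "(D has_vector_derivative - 2 * \<i> * complex_of_real (sinc (2 * pi * t * x) * (2 * pi * t) / 2 -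
      sinc (2 * pi * (t + 1) * x) * (2 * pi * (t + 1)) / 4 - sinc (2 * pi * (t - 1) * x) * (2 * pi * (t - 1)) / 4)) (at x)" for x
  proof -
    have Sc: "((\<lambda>x. Si (c * x)) has_real_derivative sinc (c * x) * c) (at x)" for c x
      by (rule DERIV_chain2[OF DERIV_Si]) (auto intro!: derivative_eq_intros)
    show ?thesis unfolding D_def
      by (intro has_vector_derivative_mult_right has_vector_derivative_of_real
           has_real_derivative_iff_has_vector_derivative[THEN iffD1] DERIV_diff DERIV_cdivide Sc)
  qed
  have D'_eq: "- 2 * \<i> * complex_of_real (sinc (2 * pi * t * x) * (2 * pi * t) / 2 -
      sinc (2 * pi * (t + 1) * x) * (2 * pi * (t + 1)) / 4 - sinc (2 * pi * (t - 1) * x) * (2 * pi * (t - 1)) / 4)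
      = h x + h (- x)" for x
  proof (cases "x = 0")
    case False
    have s: "sinc (2 * pi * c * x) * (2 * pi * c) = sin (2 * pi * c * x) / x" for c
      using False by auto
    have "sin (2 * pi * t * x) / 2 - sin (2 * pi * (t + 1) * x) / 4 - sin (2 * pi * (t - 1) * x) / 4
        = sin (2 * pi * t * x) * (1 - cos (2 * pi * x)) / 2"
      by (simp add: ring_distribs sin_add sin_diff field_simps)
    also have "1 - cos (2 * pi * x) = 2 * (sin (pi * x))\<^sup>2"
      using cos_double_sin[of "pi * x"] by (simp add: mult_ac)
    finally have "(sin (2 * pi * t * x) / 2 - sin (2 * pi * (t + 1) * x) / 4 - sin (2 * pi * (t - 1) * x) / 4) / x
        = sin (2 * pi * t * x) * (sin (pi * x))\<^sup>2 / x" by simp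
    then have "sin (2 * pi * t * x) / x / 2 - sin (2 * pi * (t + 1) * x) / x / 4 - sin (2 * pi * (t - 1) * x) / x / 4
        = sin (2 * pi * t * x) * (sin (pi * x))\<^sup>2 / x"
      by (simp add: diff_divide_distrib)
    then show ?thesis
      unfolding s by (simp add: h_def unit_exp_eq_cis complex_eq_iff mult_ac)
  qed (simp add: h_def field_simps)
  have "((\<lambda>x. G x - G (- x) - D x) has_vector_derivative 0) (at x)" for x
  proof -
    have "((\<lambda>x. G (- x)) has_vector_derivative (- 1) *\<^sub>R h (- x)) (at x)"
    proof -
      have "(uminus has_vector_derivative (- 1 :: real)) (at x)"
        by (auto intro!: derivative_eq_intros)
      from vector_diff_chain_at[OF this G] show ?thesis by (simp add: o_def)
    qed
    from has_vector_derivative_diff[OF has_vector_derivative_diff[OF G this] D'[unfolded D'_eq]]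
    show ?thesis by simp
  qed
  then obtain c where c: "\<And>x. G x - G (- x) - D x = c"
    using has_vector_derivative_zero_constant[of UNIV "\<lambda>x. G x - G (- x) - D x"] by auto
  have GD: "G x - G (- x) = D x" for x
  proof -
    have "D 0 = 0" by (simp add: D_def)
    with c[of 0] c[of x] show ?thesis by simp
  qed
  have lim_pos: "((\<lambda>x. Si (2 * pi * c * x)) \<longlongrightarrow> pi / 2) at_top" if "c > 0" for c
    by (rule filterlim_compose[OF Si_at_top], rule filterlim_tendsto_pos_mult_at_top[OF tendsto_const _ filterlim_ident])
       (use that in simp)
  have Si_lim: "((\<lambda>x. Si (2 * pi * c * x)) \<longlongrightarrow> sgn c * (pi / 2)) at_top" for c
  proof (cases c "0 :: real" rule: linorder_cases)
    case greater
    then show ?thesis using lim_pos[of c] by simp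
  next
    case less
    have "((\<lambda>x. - Si (2 * pi * (- c) * x)) \<longlongrightarrow> - (pi / 2)) at_top"
      using less by (intro tendsto_minus lim_pos) simp
    moreover have "\<forall>\<^sub>F x in at_top. - Si (2 * pi * (- c) * x) = Si (2 * pi * c * x)"
      using eventually_ge_at_top[of 0]
    proof eventually_elim
      case (elim x)
      then show ?case using Si_neg[of "2 * pi * (- c) * x"] less by (simp add: mult_nonneg_nonpos mult_nonpos_nonneg)
    qed
    ultimately show ?thesis using less by (auto intro: Lim_transform_eventually)
  qed simp
  have "(D \<longlongrightarrow> - 2 * \<i> * complex_of_real (sgn t * (pi / 2) / 2 -
      sgn (t + 1) * (pi / 2) / 4 - sgn (t - 1) * (pi / 2) / 4)) at_top"
    unfolding D_def by (intro tendsto_intros Si_lim) simp_all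
  moreover have "- 2 * \<i> * complex_of_real (sgn t * (pi / 2) / 2 - sgn (t + 1) * (pi / 2) / 4 - sgn (t - 1) * (pi / 2) / 4)
     = - \<i> * of_real (pi / 2 * sgn t)"
  proof -
    \<comment> \<open>For abs t < 1 the limits of the sine integrals for t + 1 and t - 1 are
      opposite and cancel, which leaves only the one for t.\<close>
    have "sgn (t + 1) = 1" "sgn (t - 1) = - 1" using t by (auto simp: sgn_if)
    then show ?thesis by simp
  qed
  ultimately have "((\<lambda>x. G x - G (- x)) \<longlongrightarrow> - \<i> * of_real (pi / 2 * sgn t)) at_top"
    by (simp only: GD)
  then show thesis using that G unfolding h_def by blast
qed

text \<open>Subtracting 1/x improves the decay to order 1/x^2 and so makes each term absolutely
  integrable. The correction disappears from a series whose weights sum to 0.\<close>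

definition hilbert_pair :: "int \<Rightarrow> real \<Rightarrow> real" where
  "hilbert_pair l x = (sin (pi * x))\<^sup>2 / pi\<^sup>2 * (1 / (x - of_int l) - 1 / x)"

lemma hilbert_pair_measurable [measurable]: "hilbert_pair l \<in> borel_measurable borel"
  unfolding hilbert_pair_def[abs_def] by measurable

text \<open>The difference of reciprocals is l/((x - l) x), and 2uv is at most u^2 + v^2; this
  dominates the pair by two Fejer kernels, at the price of the factor abs l.\<close>

lemma abs_hilbert_pair_le:
  "\<bar>hilbert_pair l x\<bar> \<le> \<bar>of_int l\<bar> / 2 * ((sin (pi * x))\<^sup>2 / (pi * (x - of_int l))\<^sup>2 + (sin (pi * x))\<^sup>2 / (pi * x)\<^sup>2)"
proof (cases "x = 0 \<or> x = of_int l")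
  case True
  then have "sin (pi * x) = 0" using sin_npi_int[of l] by (auto simp: mult_ac)
  then show ?thesis by (simp add: hilbert_pair_def)
next
  case False
  define u v where "u = \<bar>1 / (x - of_int l)\<bar>" and "v = \<bar>1 / x\<bar>"
  have "1 / (x - of_int l) - 1 / x = of_int l * (1 / (x - of_int l) * (1 / x))"
    using False by (simp add: field_simps)
  then have "\<bar>1 / (x - of_int l) - 1 / x\<bar> = \<bar>of_int l\<bar> * (u * v)" by (simp add: u_def v_def abs_mult)
  also have "\<dots> \<le> \<bar>of_int l\<bar> * ((u\<^sup>2 + v\<^sup>2) / 2)"
    using sum_squares_bound[of u v] by (intro mult_left_mono) auto
  finally have "(sin (pi * x))\<^sup>2 / pi\<^sup>2 * \<bar>1 / (x - of_int l) - 1 / x\<bar> \<le>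
      (sin (pi * x))\<^sup>2 / pi\<^sup>2 * (\<bar>of_int l\<bar> * ((u\<^sup>2 + v\<^sup>2) / 2))"
    by (rule mult_left_mono) simp
  also have "\<dots> = \<bar>of_int l\<bar> / 2 * ((sin (pi * x))\<^sup>2 / (pi * (x - of_int l))\<^sup>2 + (sin (pi * x))\<^sup>2 / (pi * x)\<^sup>2)"
    by (simp add: u_def v_def power_mult_distrib power_divide add_divide_distrib distrib_left mult_ac)
  finally show ?thesis by (simp add: hilbert_pair_def abs_mult)
qed

text \<open>The integral is the limit of integrals over [-n, n], expressed through the
  antiderivative \<open>G\<close> and its translate by \<open>l\<close>. The translate differs from
  \<open>G\<close> by o(1) at both ends, so only the limit of G n - G (-n), times e(-tl) - 1,
  remains.\<close>

lemma
  assumes t: "\<bar>t\<bar> < 1"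
  shows has_bochner_integral_hilbert_pair: "has_bochner_integral lborel
     (\<lambda>x. complex_of_real (hilbert_pair l x) * unit_exp (- t * x))
     (- \<i> * of_real (sgn t / (2 * pi)) * (unit_exp (- t * of_int l) - 1))"
    and integral_abs_hilbert_pair_le: "(LBINT x. \<bar>hilbert_pair l x\<bar>) \<le> \<bar>of_int l\<bar>"
proof -
  define A where "A x = complex_of_real (hilbert_pair l x) * unit_exp (- t * x)" for x
  have [measurable]: "A \<in> borel_measurable borel" unfolding A_def[abs_def] by measurable
  define g where "g x = \<bar>of_int l\<bar> / 2 * ((sin (pi * x))\<^sup>2 / (pi * (x - of_int l))\<^sup>2 + (sin (pi * x))\<^sup>2 / (pi * x)\<^sup>2)" for x
  have "has_bochner_integral lborel g (\<bar>of_int l\<bar> / 2 * (1 + 1))"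
    unfolding g_def
    using has_bochner_integral_sin_squared_scaled[of 1]
      has_bochner_integral_lborel_shift[OF has_bochner_integral_sin_squared_scaled[of 1], of "of_int l"]
    by (intro has_bochner_integral_mult_right has_bochner_integral_add) (simp_all add: sin_pi_diff_int_squared)
  then have g: "integrable lborel g" "(LBINT x. g x) = \<bar>of_int l\<bar>"
    by (simp_all add: has_bochner_integral_iff)
  have int: "integrable lborel (hilbert_pair l)"
    using g(1) by (rule Bochner_Integration.integrable_bound)
       (use abs_hilbert_pair_le in \<open>auto simp: g_def intro!: AE_I2 order_trans[OF _ abs_ge_self]\<close>)
  have "(LBINT x. \<bar>hilbert_pair l x\<bar>) \<le> (LBINT x. g x)"
  proof (rule integral_mono)
    show "\<bar>hilbert_pair l x\<bar> \<le> g x" for x unfolding g_def by (rule abs_hilbert_pair_le)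
  qed (use int g(1) in auto)
  then show "(LBINT x. \<bar>hilbert_pair l x\<bar>) \<le> \<bar>of_int l\<bar>" using g by simp
  have A: "integrable lborel A"
    using int by (rule Bochner_Integration.integrable_bound) (auto simp: A_def norm_mult)
  obtain G where
    G: "\<And>x. (G has_vector_derivative (complex_of_real ((sin (pi * x))\<^sup>2 / x) * unit_exp (- t * x))) (at x)"
    and lim: "((\<lambda>x. G x - G (- x)) \<longlongrightarrow> - \<i> * of_real (pi / 2 * sgn t)) at_top"
    using hilbert_antiderivative[OF t] by blast
  define e where "e = unit_exp (- t * of_int l)"
  define B where "B x = (e * G (x - of_int l) - G x) / of_real (pi\<^sup>2)" for x
  have B: "(B has_vector_derivative A x) (at x)" for x
  proof -
    have "((\<lambda>x. G (x - of_int l)) has_vector_derivative 1 *\<^sub>R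
       (complex_of_real ((sin (pi * (x - of_int l)))\<^sup>2 / (x - of_int l)) * unit_exp (- t * (x - of_int l)))) (at x)"
    proof -
      have "((\<lambda>x. x - of_int l) has_vector_derivative (1 :: real)) (at x)"
        by (auto intro!: derivative_eq_intros)
      from vector_diff_chain_at[OF this G] show ?thesis by (simp add: o_def)
    qed
    from has_vector_derivative_divide[OF has_vector_derivative_diff[OF has_vector_derivative_mult_right[OF this] G], of e "of_real (pi\<^sup>2)"]
    have "(B has_vector_derivative
       (e * (1 *\<^sub>R (complex_of_real ((sin (pi * (x - of_int l)))\<^sup>2 / (x - of_int l)) * unit_exp (- t * (x - of_int l))))
        - complex_of_real ((sin (pi * x))\<^sup>2 / x) * unit_exp (- t * x)) / of_real (pi\<^sup>2)) (at x)"
      unfolding B_def[abs_def] .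
    moreover have "e * unit_exp (- t * (x - of_int l)) = unit_exp (- t * x)"
      unfolding e_def unit_exp_add[symmetric] by (simp add: algebra_simps)
    then have "(e * (1 *\<^sub>R (complex_of_real ((sin (pi * (x - of_int l)))\<^sup>2 / (x - of_int l)) * unit_exp (- t * (x - of_int l))))
        - complex_of_real ((sin (pi * x))\<^sup>2 / x) * unit_exp (- t * x)) / of_real (pi\<^sup>2) = A x"
      unfolding sin_pi_diff_int_squared A_def hilbert_pair_def
      by (simp add: field_simps)
    ultimately show ?thesis by simp
  qed
  \<comment> \<open>Mean value inequality: the derivative of \<open>G\<close> at y has norm at most
    1/abs y, and y stays within distance abs c of x.\<close>
  have G_diff: "norm (G (x - c) - G x) \<le> \<bar>c\<bar> * (1 / (\<bar>x\<bar> - \<bar>c\<bar>))" if "\<bar>c\<bar> < \<bar>x\<bar>" for x c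
  proof (cases "c = 0")
    case False
    define a b where "a = min (x - c) x" and "b = max (x - c) x"
    have ab: "a < b" using False by (auto simp: a_def b_def)
    have "continuous_on {a..b} G"
      using G by (meson continuous_at_imp_continuous_on has_vector_derivative_continuous)
    then obtain y where y: "y \<in> {a<..<b}" "norm (G b - G a) \<le>
        norm ((b - a) *\<^sub>R (complex_of_real ((sin (pi * y))\<^sup>2 / y) * unit_exp (- t * y)))"
      using mvt_general[OF ab, of G "\<lambda>y s. s *\<^sub>R (complex_of_real ((sin (pi * y))\<^sup>2 / y) * unit_exp (- t * y))"]
        G[unfolded has_vector_derivative_def] by blast
    have "norm (G (x - c) - G x) = norm (G b - G a)"
      by (auto simp: a_def b_def min_def max_def norm_minus_commute)
    also have "\<dots> \<le> \<bar>c\<bar> * ((sin (pi * y))\<^sup>2 / \<bar>y\<bar>)"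
    proof -
      have "b - a = \<bar>c\<bar>" by (auto simp: a_def b_def)
      moreover have "norm (complex_of_real ((sin (pi * y))\<^sup>2 / y) * unit_exp (- t * y)) = (sin (pi * y))\<^sup>2 / \<bar>y\<bar>"
        unfolding norm_mult norm_of_real by simp
      ultimately show ?thesis using y(2) unfolding norm_scaleR by simp
    qed
    also have "\<dots> \<le> \<bar>c\<bar> * (1 / (\<bar>x\<bar> - \<bar>c\<bar>))"
    proof (intro mult_left_mono frac_le)
      show "(sin (pi * y))\<^sup>2 \<le> 1" by (simp add: abs_square_le_1)
      show "\<bar>x\<bar> - \<bar>c\<bar> \<le> \<bar>y\<bar>" using y(1) by (auto simp: a_def b_def)
    qed (use that in auto)
    finally show ?thesis .
  qed simp
  have G_lim: "((\<lambda>n::nat. G (\<sigma> * real n - c) - G (\<sigma> * real n)) \<longlongrightarrow> 0) sequentially" if "\<bar>\<sigma>\<bar> = 1" for \<sigma> c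
  proof (rule Lim_null_comparison)
    show "\<forall>\<^sub>F n in sequentially. norm (G (\<sigma> * real n - c) - G (\<sigma> * real n)) \<le> \<bar>c\<bar> * (1 / (real n - \<bar>c\<bar>))"
      using eventually_gt_at_top[of "nat \<lceil>\<bar>c\<bar>\<rceil>"]
    proof eventually_elim
      case (elim n)
      then have "\<bar>c\<bar> < \<bar>\<sigma> * real n\<bar>" using that by (simp add: abs_mult) linarith
      from G_diff[OF this] show ?case using that by (simp add: abs_mult)
    qed
    show "((\<lambda>n::nat. \<bar>c\<bar> * (1 / (real n - \<bar>c\<bar>))) \<longlongrightarrow> 0) sequentially" by real_asymp
  qed
  have set_int: "set_integrable lborel {- real n..real n} A" for n
    unfolding set_integrable_def using A by (rule integrable_mult_indicator[rotated]) simp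
  have trunc: "(LBINT x. indicator {- real n..real n} x *\<^sub>R A x) = B (real n) - B (- real n)" for n
  proof -
    have "(LBINT x:{- real n..real n}. A x) = integral {- real n..real n} A"
      by (rule set_borel_integral_eq_integral(2)[OF set_int])
    also have "\<dots> = B (real n) - B (- real n)"
      by (intro integral_unique fundamental_theorem_of_calculus has_vector_derivative_at_within[OF B]) auto
    finally show ?thesis by (simp add: set_lebesgue_integral_def)
  qed
  \<comment> \<open>Regrouped so that every difference of \<open>G\<close> is either symmetric, with
    known limit, or a translation difference, with limit 0.\<close>
  have B_eq: "B (real n) - B (- real n) =
    ((e - 1) * (G (real n) - G (- real n)) + e * (G (1 * real n - of_int l) - G (1 * real n))
       - e * (G (- 1 * real n - of_int l) - G (- 1 * real n))) / of_real (pi\<^sup>2)" for n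
    by (simp add: B_def field_simps)
  have "(\<lambda>n. LBINT x. indicator {- real n..real n} x *\<^sub>R A x) \<longlonglongrightarrow> 
      ((e - 1) * (- \<i> * of_real (pi / 2 * sgn t)) + e * 0 - e * 0) / of_real (pi\<^sup>2)"
    unfolding trunc B_eq
    by (intro tendsto_intros G_lim filterlim_compose[OF lim] filterlim_real_sequentially) auto
  moreover have "(\<lambda>n. LBINT x. indicator {- real n..real n} x *\<^sub>R A x) \<longlonglongrightarrow> (LBINT x. A x)"
  proof (rule integral_dominated_convergence)
    show "integrable lborel (\<lambda>x. norm (A x))" using A by simp
    show "AE x in lborel. (\<lambda>n. indicator {- real n..real n} x *\<^sub>R A x) \<longlonglongrightarrow> A x"
    proof (intro AE_I2 tendsto_eventually)
      fix x :: real
      show "\<forall>\<^sub>F n in sequentially. indicator {- real n..real n} x *\<^sub>R A x = A x"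
        using eventually_gt_at_top[of "nat \<lceil>\<bar>x\<bar>\<rceil>"]
        by eventually_elim (auto simp: indicator_def, linarith+)
    qed
    show "AE x in lborel. norm (indicator {- real n..real n} x *\<^sub>R A x) \<le> norm (A x)" for n
      by (auto simp: indicator_def)
  qed (use A in \<open>auto simp: integrable_iff_bounded\<close>)
  ultimately have "(LBINT x. A x) = ((e - 1) * (- \<i> * of_real (pi / 2 * sgn t)) + e * 0 - e * 0) / of_real (pi\<^sup>2)"
    using LIMSEQ_unique by blast
  also have "\<dots> = - \<i> * of_real (sgn t / (2 * pi)) * (e - 1)"
    by (simp add: field_simps power2_eq_square)
  finally show "has_bochner_integral lborel
     (\<lambda>x. complex_of_real (hilbert_pair l x) * unit_exp (- t * x))
     (- \<i> * of_real (sgn t / (2 * pi)) * (unit_exp (- t * of_int l) - 1))"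
    using A by (simp add: has_bochner_integral_iff A_def[abs_def] e_def)
qed

section \<open>Termwise transformation of interpolation series\<close>

lemma has_sum_int_imp_sums:
  fixes f :: "int \<Rightarrow> 'a :: {comm_monoid_add, topological_space, t2_space}"
  assumes "(f has_sum S) UNIV"
  shows "(\<lambda>n. f (int_decode n)) sums S"
proof -
  have "((\<lambda>n. f (int_decode n)) has_sum S) UNIV"
    using has_sum_reindex_bij_betw[OF bij_int_decode, of f S] assms by simp
  then show ?thesis by (rule has_sum_imp_sums)
qed

text \<open>Enumerating the integers by \<open>int_decode\<close> reduces the interchange of sum and
  integral to ordinary series.\<close>

lemma has_bochner_integral_infsum_int:
  fixes f :: "int \<Rightarrow> 'b \<Rightarrow> complex"
  assumes f: "\<And>k. has_bochner_integral M (f k) (I k)"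
    and sum: "\<And>x. (\<lambda>k. norm (f k x)) summable_on UNIV"
    and bnd: "\<And>k. (LINT x|M. norm (f k x)) \<le> B k" "B summable_on UNIV"
  shows "has_bochner_integral M (\<lambda>x. \<Sum>\<^sub>\<infinity>k. f k x) (\<Sum>\<^sub>\<infinity>k. I k)"
proof -
  have int: "integrable M (f k)" "(LINT x|M. f k x) = I k" for k
    using f by (auto simp: has_bochner_integral_iff)
  have B: "norm (I k) \<le> B k" for k
    using integral_norm_bound[of M "f k"] bnd(1)[of k] int(2) by (simp add: order_trans)
  then have normI: "(\<lambda>k. norm (I k)) summable_on UNIV"
    by (intro summable_on_comparison_test[OF bnd(2)]) auto
  have sum_norm: "summable (\<lambda>n. norm (f (int_decode n) x))" for x
    using has_sum_int_imp_sums[OF has_sum_infsum[OF sum[of x]]] by (rule sums_summable)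
  have sumB: "summable (\<lambda>n. B (int_decode n))"
    using has_sum_int_imp_sums[OF has_sum_infsum[OF bnd(2)]] by (rule sums_summable)
  have sums: "summable (\<lambda>n. LINT x|M. norm (f (int_decode n) x))"
    by (rule summable_comparison_test'[OF sumB, of 0]) (use bnd(1) in simp)
  have fx: "(\<Sum>\<^sub>\<infinity>k. f k x) = (\<Sum>n. f (int_decode n) x)" for x
    using has_sum_int_imp_sums[OF has_sum_infsum[OF abs_summable_summable[OF sum[of x]]]] by (simp add: sums_iff)
  have Ix: "(\<Sum>\<^sub>\<infinity>k. I k) = (\<Sum>n. I (int_decode n))"
    using has_sum_int_imp_sums[OF has_sum_infsum[OF abs_summable_summable[OF normI]]] by (simp add: sums_iff)
  show "has_bochner_integral M (\<lambda>x. \<Sum>\<^sub>\<infinity>k. f k x) (\<Sum>\<^sub>\<infinity>k. I k)"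
    unfolding fx Ix has_bochner_integral_iff
    using integrable_suminf[of M "\<lambda>n. f (int_decode n)"] integral_suminf[of M "\<lambda>n. f (int_decode n)"]
      int sum_norm sums by simp
qed

lemma fejer_le_1: "(sin (pi * x))\<^sup>2 / (pi * (x - of_int k))\<^sup>2 \<le> 1"
proof -
  have "\<bar>sin (pi * (x - of_int k))\<bar> \<le> \<bar>pi * (x - of_int k)\<bar>" by (rule abs_sin_x_le_abs_x)
  then have "(sin (pi * x))\<^sup>2 \<le> (pi * (x - of_int k))\<^sup>2"
    unfolding sin_pi_diff_int_squared[of x k, symmetric] by (simp add: abs_le_square_iff)
  then show ?thesis by (simp add: divide_le_eq_1)
qed

lemma abs_hilbert_pair_le_int: "\<bar>hilbert_pair l x\<bar> \<le> \<bar>of_int l\<bar>"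
proof -
  have "\<bar>hilbert_pair l x\<bar> \<le> \<bar>of_int l\<bar> / 2 * (1 + 1)"
    using fejer_le_1[of x l] fejer_le_1[of x 0]
    by (intro order_trans[OF abs_hilbert_pair_le] mult_left_mono add_mono) auto
  then show ?thesis by simp
qed

lemma has_bochner_integral_interpolation_series:
  fixes a b :: "int \<Rightarrow> real"
  assumes t: "\<bar>t\<bar> < 1" and a: "(\<lambda>k. \<bar>a k\<bar>) summable_on UNIV"
    and bl: "(\<lambda>l. \<bar>b l\<bar> * \<bar>of_int l\<bar>) summable_on UNIV"
  shows "has_bochner_integral lborel
    (\<lambda>x. (\<Sum>\<^sub>\<infinity>k. of_real (a k * ((sin (pi * x))\<^sup>2 / (pi * (x - of_int k))\<^sup>2)) * unit_exp (- t * x)) +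
         (\<Sum>\<^sub>\<infinity>l. of_real (b l * hilbert_pair l x) * unit_exp (- t * x)))
    ((\<Sum>\<^sub>\<infinity>k. of_real (a k) * (of_real (1 - \<bar>t\<bar>) * unit_exp (- t * of_int k))) +
     (\<Sum>\<^sub>\<infinity>l. of_real (b l) * (- \<i> * of_real (sgn t / (2 * pi)) * (unit_exp (- t * of_int l) - 1))))"
proof (intro has_bochner_integral_add has_bochner_integral_infsum_int)
  show "has_bochner_integral lborel
     (\<lambda>x. of_real (a k * ((sin (pi * x))\<^sup>2 / (pi * (x - of_int k))\<^sup>2)) * unit_exp (- t * x))
     (of_real (a k) * (of_real (1 - \<bar>t\<bar>) * unit_exp (- t * of_int k)))" for k
    using has_bochner_integral_mult_right[OF has_bochner_integral_fejer_shift[of t k], of "of_real (a k)"] t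
    by (simp add: mult_ac)
  show "(\<lambda>k. norm (complex_of_real (a k * ((sin (pi * x))\<^sup>2 / (pi * (x - of_int k))\<^sup>2)) * unit_exp (- t * x))) summable_on UNIV" for x
  proof (rule summable_on_comparison_test[OF a])
    show "norm (complex_of_real (a k * ((sin (pi * x))\<^sup>2 / (pi * (x - of_int k))\<^sup>2)) * unit_exp (- t * x)) \<le> \<bar>a k\<bar>" for k
      using mult_left_mono[OF fejer_le_1[of x k], of "\<bar>a k\<bar>"]
      unfolding norm_mult norm_of_real by (simp add: abs_mult)
  qed simp
  show "(LBINT x. norm (complex_of_real (a k * ((sin (pi * x))\<^sup>2 / (pi * (x - of_int k))\<^sup>2)) * unit_exp (- t * x))) \<le> \<bar>a k\<bar>" for k
  proof -
    have "has_bochner_integral lborel (\<lambda>x. \<bar>a k\<bar> * ((sin (pi * x))\<^sup>2 / (pi * (x - of_int k))\<^sup>2)) (\<bar>a k\<bar> * 1)"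
      using has_bochner_integral_lborel_shift[OF has_bochner_integral_sin_squared_scaled[of 1], of "of_int k"]
      by (intro has_bochner_integral_mult_right) (simp add: sin_pi_diff_int_squared)
    then show ?thesis
      unfolding norm_mult norm_of_real by (simp add: abs_mult has_bochner_integral_iff)
  qed
  show "(\<lambda>k. \<bar>a k\<bar>) summable_on UNIV" by (rule a)
  show "has_bochner_integral lborel (\<lambda>x. of_real (b l * hilbert_pair l x) * unit_exp (- t * x))
     (of_real (b l) * (- \<i> * of_real (sgn t / (2 * pi)) * (unit_exp (- t * of_int l) - 1)))" for l
    using has_bochner_integral_mult_right[OF has_bochner_integral_hilbert_pair[OF t, of l], of "of_real (b l)"]
    by (simp add: mult_ac)
  show "(\<lambda>l. norm (complex_of_real (b l * hilbert_pair l x) * unit_exp (- t * x))) summable_on UNIV" for x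
    by (rule summable_on_comparison_test[OF bl])
       (auto simp: norm_mult abs_mult intro!: mult_left_mono abs_hilbert_pair_le_int)
  show "(LBINT x. norm (complex_of_real (b l * hilbert_pair l x) * unit_exp (- t * x))) \<le> \<bar>b l\<bar> * \<bar>of_int l\<bar>" for l
    using mult_left_mono[OF integral_abs_hilbert_pair_le[OF t, of l], of "\<bar>b l\<bar>"]
    by (simp add: norm_mult abs_mult)
  show "(\<lambda>l. \<bar>b l\<bar> * \<bar>of_int l\<bar>) summable_on UNIV" by (rule bl)
qed

text \<open>The common shape of both kernels: M has its nodes at the integers, and L is a translate
  by 1/2, since cos(pi z) = - sin(pi (z - 1/2)).\<close>

definition interpolation_series :: "(int \<Rightarrow> real) \<Rightarrow> (int \<Rightarrow> real) \<Rightarrow> complex \<Rightarrow> complex" where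
  "interpolation_series a b z = (sin (of_real pi * z) / of_real pi)\<^sup>2 *
     ((\<Sum>\<^sub>\<infinity>k. of_real (a k) / (z - of_int k)\<^sup>2) + (\<Sum>\<^sub>\<infinity>l. of_real (b l) / (z - of_int l)))"

lemma isCont_infsum_M_test:
  fixes f :: "'a \<Rightarrow> 'b :: metric_space \<Rightarrow> 'c :: banach"
  assumes "open U" "z \<in> U" "\<And>k. continuous_on U (f k)" "\<And>k x. x \<in> U \<Longrightarrow> norm (f k x) \<le> M k" "M summable_on UNIV"
  shows "isCont (\<lambda>x. \<Sum>\<^sub>\<infinity>k. f k x) z"
proof -
  have "uniform_limit U (\<lambda>X x. \<Sum>k\<in>X. f k x) (\<lambda>x. \<Sum>\<^sub>\<infinity>k. f k x) (finite_subsets_at_top UNIV)"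
    using assms(4,5) by (intro Weierstrass_m_test_general)
  then have "continuous_on U (\<lambda>x. \<Sum>\<^sub>\<infinity>k. f k x)"
    by (rule uniform_limit_theorem[rotated]) (use assms(3) in \<open>auto intro!: always_eventually continuous_on_sum\<close>)
  then show ?thesis using assms(1,2) by (simp add: continuous_on_eq_continuous_at)
qed

text \<open>Continuity off the integers ensures that \<open>remove_sings\<close> keeps the value of
  the series there.\<close>

lemma isCont_interpolation_series:
  assumes z: "z \<notin> \<int>" and a: "(\<lambda>k. \<bar>a k\<bar>) summable_on UNIV" and b: "(\<lambda>k. \<bar>b k\<bar>) summable_on UNIV"
  shows "isCont (interpolation_series a b) z"
proof -
  \<comment> \<open>On the ball of radius r/2 every integer is at distance at least r/2, which
    bounds all terms by multiples of the weights.\<close>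
  obtain r where r: "r > 0" "ball z r \<subseteq> - \<int>"
    using z open_contains_ball[of "- \<int> :: complex set"] closed_Ints by (auto simp: open_Compl)
  have far: "norm (w - of_int k) \<ge> r / 2" if "w \<in> ball z (r / 2)" for w k
  proof (rule ccontr)
    assume *: "\<not> norm (w - of_int k) \<ge> r / 2"
    have "dist z (of_int k) \<le> dist z w + dist w (of_int k)" by (rule dist_triangle)
    also have "\<dots> < r" using * that by (simp add: dist_norm)
    finally show False using r(2) by auto
  qed
  then have ne: "w - of_int k \<noteq> 0" if "w \<in> ball z (r / 2)" for w k
    using far[OF that, of k] r(1) by auto
  have "isCont (\<lambda>z. \<Sum>\<^sub>\<infinity>k. of_real (a k) / (z - of_int k)\<^sup>2) z"
  proof (rule isCont_infsum_M_test[of "ball z (r / 2)"])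
    show "(\<lambda>k. \<bar>a k\<bar> / (r / 2)\<^sup>2) summable_on UNIV"
      using summable_on_cmult_left[OF a, of "inverse ((r / 2)\<^sup>2)"] by (simp add: field_simps)
    show "norm (of_real (a k) / (w - of_int k)\<^sup>2) \<le> \<bar>a k\<bar> / (r / 2)\<^sup>2" if "w \<in> ball z (r / 2)" for k w
      using far[OF that, of k] r(1) unfolding norm_divide norm_power norm_of_real
      by (intro frac_le power_mono) auto
    show "continuous_on (ball z (r / 2)) (\<lambda>w. of_real (a k) / (w - of_int k)\<^sup>2)" for k
      using ne by (intro continuous_intros) auto
  qed (use r in auto)
  moreover have "isCont (\<lambda>z. \<Sum>\<^sub>\<infinity>l. of_real (b l) / (z - of_int l)) z"
  proof (rule isCont_infsum_M_test[of "ball z (r / 2)"])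
    show "(\<lambda>k. \<bar>b k\<bar> / (r / 2)) summable_on UNIV"
      using summable_on_cmult_left[OF b, of "inverse (r / 2)"] by (simp add: field_simps)
    show "norm (of_real (b k) / (w - of_int k)) \<le> \<bar>b k\<bar> / (r / 2)" if "w \<in> ball z (r / 2)" for k w
      using far[OF that, of k] r(1) unfolding norm_divide norm_of_real
      by (intro frac_le) auto
    show "continuous_on (ball z (r / 2)) (\<lambda>w. of_real (b k) / (w - of_int k))" for k
      using ne by (intro continuous_intros) auto
  qed (use r in auto)
  ultimately show ?thesis
    unfolding interpolation_series_def[abs_def] by (intro continuous_intros) auto
qed

text \<open>Since \<open>b\<close> sums to 0, subtracting the same 1/x from every 1/(x - l) does not
  change the second series.\<close>

lemma interpolation_series_of_real:
  assumes x: "x \<notin> \<int>" and a: "(\<lambda>k. \<bar>a k\<bar>) summable_on UNIV"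
    and bl: "(\<lambda>l. \<bar>b l\<bar> * \<bar>of_int l\<bar>) summable_on UNIV"
    and b: "(b has_sum 0) UNIV"
  shows "interpolation_series a b (of_real x) =
    (\<Sum>\<^sub>\<infinity>k. of_real (a k * ((sin (pi * x))\<^sup>2 / (pi * (x - of_int k))\<^sup>2))) + (\<Sum>\<^sub>\<infinity>l. of_real (b l * hilbert_pair l x))"
proof -
  define c where "c = complex_of_real ((sin (pi * x))\<^sup>2 / pi\<^sup>2)"
  have c: "(sin (of_real pi * of_real x) / complex_of_real pi)\<^sup>2 = c"
    by (simp add: c_def power_divide flip: of_real_mult sin_of_real)
  have "c * (\<Sum>\<^sub>\<infinity>k. of_real (a k) / (of_real x - of_int k)\<^sup>2) =
     (\<Sum>\<^sub>\<infinity>k. of_real (a k * ((sin (pi * x))\<^sup>2 / (pi * (x - of_int k))\<^sup>2)))"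
    unfolding infsum_cmult_right'[symmetric] by (simp add: c_def power_mult_distrib mult_ac)
  moreover have "c * (\<Sum>\<^sub>\<infinity>l. of_real (b l) / (of_real x - of_int l)) = (\<Sum>\<^sub>\<infinity>l. of_real (b l * hilbert_pair l x))"
  proof -
    have sum: "(\<lambda>l. complex_of_real (b l * hilbert_pair l x)) summable_on UNIV"
      by (rule abs_summable_summable, rule summable_on_comparison_test[OF bl])
         (auto simp: norm_mult abs_mult intro!: mult_left_mono abs_hilbert_pair_le_int)
    have "((\<lambda>l. of_real (b l) * (c / of_real x)) has_sum (of_real 0 * (c / of_real x))) UNIV"
      by (intro has_sum_cmult_left has_sum_of_real b)
    from has_sum_add[OF has_sum_infsum[OF sum] this]
    have "((\<lambda>l. of_real (b l * hilbert_pair l x) + of_real (b l) * (c / of_real x)) has_sum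
       (\<Sum>\<^sub>\<infinity>l. of_real (b l * hilbert_pair l x))) UNIV" by simp
    moreover have "of_real (b l * hilbert_pair l x) + of_real (b l) * (c / of_real x) =
        c * (of_real (b l) / (of_real x - of_int l))" for l
    proof -
      have "b l * hilbert_pair l x + b l * ((sin (pi * x))\<^sup>2 / pi\<^sup>2 * (1 / x)) =
          (sin (pi * x))\<^sup>2 / pi\<^sup>2 * (b l * (1 / (x - of_int l)))"
        unfolding hilbert_pair_def by (simp only: algebra_simps)
      from arg_cong[OF this, of complex_of_real] show ?thesis by (simp add: c_def)
    qed
    ultimately show ?thesis
      unfolding infsum_cmult_right'[symmetric] by (simp add: infsumI)
  qed
  ultimately show ?thesis by (simp add: interpolation_series_def c distrib_left)
qed

lemma integral_remove_sings_interpolation_series: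
  fixes a b :: "int \<Rightarrow> real"
  assumes t: "\<bar>t\<bar> < 1" and a: "(\<lambda>k. \<bar>a k\<bar>) summable_on UNIV"
    and bl: "(\<lambda>l. \<bar>b l\<bar> * \<bar>of_int l\<bar>) summable_on UNIV"
    and b: "(\<lambda>k. \<bar>b k\<bar>) summable_on UNIV" "(b has_sum 0) UNIV"
  shows "(LBINT x. remove_sings (\<lambda>z. interpolation_series a b (z - of_real s)) (of_real x) * unit_exp (- t * x)) =
    of_real (1 - \<bar>t\<bar>) * (\<Sum>\<^sub>\<infinity>k. of_real (a k) * unit_exp (- t * (of_int k + s))) -
    \<i> * of_real (sgn t / (2 * pi)) * (\<Sum>\<^sub>\<infinity>k. of_real (b k) * unit_exp (- t * (of_int k + s)))"
proof -
  define A where "A = (\<Sum>\<^sub>\<infinity>k. complex_of_real (a k) * unit_exp (- t * of_int k))"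
  define B where "B = (\<Sum>\<^sub>\<infinity>k. complex_of_real (b k) * unit_exp (- t * of_int k))"
  define f where "f x = (\<Sum>\<^sub>\<infinity>k. complex_of_real (a k * ((sin (pi * x))\<^sup>2 / (pi * (x - of_int k))\<^sup>2)) * unit_exp (- t * x)) +
         (\<Sum>\<^sub>\<infinity>l. of_real (b l * hilbert_pair l x) * unit_exp (- t * x))" for x
  have f_int: "has_bochner_integral lborel f
     ((\<Sum>\<^sub>\<infinity>k. of_real (a k) * (of_real (1 - \<bar>t\<bar>) * unit_exp (- t * of_int k))) +
     (\<Sum>\<^sub>\<infinity>l. of_real (b l) * (- \<i> * of_real (sgn t / (2 * pi)) * (unit_exp (- t * of_int l) - 1))))"
    unfolding f_def by (rule has_bochner_integral_interpolation_series[OF t a bl])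
  have 1: "(\<Sum>\<^sub>\<infinity>k. of_real (a k) * (of_real (1 - \<bar>t\<bar>) * unit_exp (- t * of_int k))) = of_real (1 - \<bar>t\<bar>) * A"
    unfolding A_def infsum_cmult_right'[symmetric] by (simp only: mult_ac)
  have 2: "(\<Sum>\<^sub>\<infinity>l. of_real (b l) * (- \<i> * of_real (sgn t / (2 * pi)) * (unit_exp (- t * of_int l) - 1))) =
      - \<i> * of_real (sgn t / (2 * pi)) * B"
  proof -
    define \<kappa> where "\<kappa> = - \<i> * complex_of_real (sgn t / (2 * pi))"
    have sB: "(\<lambda>k. complex_of_real (b k) * unit_exp (- t * of_int k)) summable_on UNIV"
      by (rule abs_summable_summable) (use b(1) in \<open>simp add: norm_mult\<close>)
    have "((\<lambda>k. of_real (b k) * unit_exp (- t * of_int k) + of_real (b k) * (- 1)) has_sum (B + of_real 0 * (- 1))) UNIV"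
      unfolding B_def by (intro has_sum_add has_sum_cmult_left has_sum_infsum sB has_sum_of_real b)
    note has_sum_cmult_right[OF this, of \<kappa>]
    moreover have "\<kappa> * (of_real (b k) * unit_exp (- t * of_int k) + of_real (b k) * (- 1)) =
        of_real (b k) * (\<kappa> * (unit_exp (- t * of_int k) - 1))" for k
      by (simp add: algebra_simps)
    ultimately show ?thesis
      unfolding \<kappa>_def[symmetric] by (intro infsumI) (simp only: mult_zero_left of_real_0 add_0_right)
  qed
  have "(LBINT x. remove_sings (\<lambda>z. interpolation_series a b (z - of_real s)) (of_real x) * unit_exp (- t * x)) =
     (LBINT x. unit_exp (- t * s) * f (x - s))"
  \<comment> \<open>The integrands are compared only off the shifted integers, a countable set of
    measure 0.\<close>
  proof (rule integral_discrete_difference[of "range (\<lambda>k::int. of_int k + s)"])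
    fix x :: real
    assume "x \<notin> range (\<lambda>k::int. of_int k + s)"
    then have "x - s \<noteq> of_int k" for k by (auto simp: algebra_simps)
    then have x: "x - s \<notin> \<int>" by (auto elim!: Ints_cases)
    then have "complex_of_real (x - s) \<notin> \<int>"
      by (metis Ints_cases Ints_of_int of_real_of_int_eq of_real_eq_iff)
    then have "isCont (\<lambda>z. interpolation_series a b (z - of_real s)) (of_real x)"
      by (intro isCont_o2[OF _ isCont_interpolation_series[OF _ a b(1)]] continuous_intros) simp
    then have "remove_sings (\<lambda>z. interpolation_series a b (z - of_real s)) (of_real x) =
        interpolation_series a b (of_real (x - s))"
      by (intro remove_sings_eqI) (simp add: isCont_def)
    moreover have "interpolation_series a b (of_real (x - s)) * unit_exp (- t * (x - s)) = f (x - s)"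
      unfolding interpolation_series_of_real[OF x a bl b(2)] f_def infsum_cmult_left' distrib_right ..
    moreover have "unit_exp (- t * x) = unit_exp (- t * s) * unit_exp (- t * (x - s))"
      unfolding unit_exp_add[symmetric] by (simp add: algebra_simps)
    ultimately show "remove_sings (\<lambda>z. interpolation_series a b (z - of_real s)) (of_real x) * unit_exp (- t * x) =
        unit_exp (- t * s) * f (x - s)"
      by (metis mult.left_commute)
  qed auto
  also have "\<dots> = unit_exp (- t * s) * (of_real (1 - \<bar>t\<bar>) * A - \<i> * of_real (sgn t / (2 * pi)) * B)"
    using has_bochner_integral_mult_right[OF has_bochner_integral_lborel_shift[OF f_int, of s], of "unit_exp (- t * s)"]
    unfolding 1 2 by (simp add: has_bochner_integral_iff)
  also have "\<dots> = of_real (1 - \<bar>t\<bar>) * (unit_exp (- t * s) * A) - \<i> * of_real (sgn t / (2 * pi)) * (unit_exp (- t * s) * B)"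
    by (simp add: algebra_simps)
  also have "unit_exp (- t * s) * A = (\<Sum>\<^sub>\<infinity>k. of_real (a k) * unit_exp (- t * (of_int k + s)))"
    unfolding A_def infsum_cmult_right'[symmetric] distrib_left unit_exp_add by (simp only: mult_ac)
  also have "unit_exp (- t * s) * B = (\<Sum>\<^sub>\<infinity>k. of_real (b k) * unit_exp (- t * (of_int k + s)))"
    unfolding B_def infsum_cmult_right'[symmetric] distrib_left unit_exp_add by (simp only: mult_ac)
  finally show ?thesis .
qed

section \<open>Values at the nodes\<close>

text \<open>Samples of exp(-lam abs x) at the points k + s. The signed weights are its derivative
  divided by -lam, with the value 0 at the corner.\<close>

definition node_wt :: "real \<Rightarrow> real \<Rightarrow> int \<Rightarrow> real" where
  "node_wt s lam k = exp (- lam * \<bar>of_int k + s\<bar>)"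

definition node_sgn_wt :: "real \<Rightarrow> real \<Rightarrow> int \<Rightarrow> real" where
  "node_sgn_wt s lam k = sgn (of_int k + s) * exp (- lam * \<bar>of_int k + s\<bar>)"

lemma summable_node_wt:
  assumes "lam > 0" "0 \<le> s" "s \<le> 1"
  shows "(\<lambda>k. \<bar>node_wt s lam k\<bar>) summable_on UNIV"
  using has_sum_imp_summable[OF has_sum_exp_abs[OF assms]] by (simp add: node_wt_def add.commute)

lemma summable_node_sgn_wt:
  assumes "lam > 0" "0 \<le> s" "s \<le> 1"
  shows "(\<lambda>k. \<bar>node_sgn_wt s lam k\<bar>) summable_on UNIV"
  by (rule summable_on_comparison_test[OF summable_node_wt[OF assms]])
     (auto simp: node_wt_def node_sgn_wt_def abs_mult sgn_if)

lemma summable_node_sgn_wt_mult: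
  assumes "lam > 0" "0 \<le> s" "s \<le> 1"
  shows "(\<lambda>k. \<bar>node_sgn_wt s lam k\<bar> * \<bar>of_int k\<bar>) summable_on UNIV"
proof (rule summable_on_comparison_test)
  show "(\<lambda>k. \<bar>node_wt s (lam / 2) k\<bar> * (2 / lam + 1)) summable_on UNIV"
    using assms by (intro summable_on_cmult_left summable_node_wt) auto
  fix k :: int
  define y where "y = \<bar>of_int k + s\<bar>"
  have y: "y \<ge> 0" "\<bar>of_int k\<bar> \<le> y + 1" using assms by (auto simp: y_def)
  \<comment> \<open>One half of the exponent absorbs the linear factor y + 1, the other keeps the
    series summable.\<close>
  have "exp (- lam * y) = exp (- (lam / 2) * y) * exp (- (lam / 2) * y)" by (simp flip: exp_add)
  moreover have "(y + 1) * exp (- (lam / 2) * y) \<le> 2 / lam + 1"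
  proof -
    have "lam / 2 * y \<le> exp (lam / 2 * y)" using exp_ge_add_one_self[of "lam / 2 * y"] by linarith
    then have "y * exp (- (lam / 2) * y) \<le> 2 / lam" using assms by (simp add: exp_minus field_simps)
    moreover have "exp (- (lam / 2) * y) \<le> 1" using assms y by simp
    ultimately show ?thesis unfolding distrib_right mult_1_left by (rule add_mono)
  qed
  ultimately have "exp (- lam * y) * (y + 1) \<le> exp (- (lam / 2) * y) * (2 / lam + 1)"
    using mult_left_mono[of "(y + 1) * exp (- (lam / 2) * y)" "2 / lam + 1" "exp (- (lam / 2) * y)"]
    by (simp add: mult_ac)
  moreover have "\<bar>node_sgn_wt s lam k\<bar> * \<bar>of_int k\<bar> \<le> exp (- lam * y) * (y + 1)"
    using y by (intro mult_mono) (auto simp: node_sgn_wt_def y_def abs_mult sgn_if)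
  ultimately show "\<bar>node_sgn_wt s lam k\<bar> * \<bar>of_int k\<bar> \<le> \<bar>node_wt s (lam / 2) k\<bar> * (2 / lam + 1)"
    by (simp add: node_wt_def y_def)
qed auto

lemma infsum_int_reflect: "(\<Sum>\<^sub>\<infinity>k::int. f (- k - c)) = infsum f UNIV"
  by (rule infsum_reindex_bij_witness[of _ "\<lambda>k. - k - c" "\<lambda>k. - k - c"]) auto

text \<open>That 2s is an integer means that the grid of points k + s is symmetric about 0; the
  reflection sends k to -k - c.\<close>

lemma node_wt_reflect:
  assumes "2 * s = of_int c"
  shows "node_wt s lam (- k - c) = node_wt s lam k" "node_sgn_wt s lam (- k - c) = - node_sgn_wt s lam k"
    "of_int (- k - c) + s = - (of_int k + s)"
proof -
  show *: "of_int (- k - c) + s = - (of_int k + s)" using assms by simp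
  show "node_wt s lam (- k - c) = node_wt s lam k" "node_sgn_wt s lam (- k - c) = - node_sgn_wt s lam k"
    unfolding node_wt_def node_sgn_wt_def * by (simp_all only: abs_minus sgn_minus mult_minus_left)
qed

lemma has_sum_node_sgn_wt:
  assumes "lam > 0" "0 \<le> s" "s \<le> 1" "2 * s = of_int c"
  shows "(node_sgn_wt s lam has_sum 0) UNIV"
proof -
  have "infsum (node_sgn_wt s lam) UNIV = (\<Sum>\<^sub>\<infinity>k. node_sgn_wt s lam (- k - c))"
    by (rule infsum_int_reflect[symmetric])
  also have "\<dots> = - infsum (node_sgn_wt s lam) UNIV"
    unfolding node_wt_reflect(2)[OF assms(4)] by (rule infsum_uminus)
  finally have "infsum (node_sgn_wt s lam) UNIV = 0" by simp
  moreover have "node_sgn_wt s lam summable_on UNIV"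
    by (rule abs_summable_summable) (use summable_node_sgn_wt[OF assms(1-3)] in simp)
  ultimately show ?thesis using has_sum_infsum by metis
qed

text \<open>The closed form of both transforms for abs t < 1: s = 0 gives M and s = 1/2 gives
  L.\<close>

definition interp_hat :: "real \<Rightarrow> real \<Rightarrow> real \<Rightarrow> complex" where
  "interp_hat s lam t =
     of_real (1 - \<bar>t\<bar>) * (\<Sum>\<^sub>\<infinity>k. of_real (node_wt s lam k) * unit_exp (- t * (of_int k + s))) +
     \<i> * of_real (lam * sgn t / (2 * pi)) * (\<Sum>\<^sub>\<infinity>k. of_real (node_sgn_wt s lam k) * unit_exp (- t * (of_int k + s)))"

lemma interp_hat_eq_integral:
  assumes "lam > 0" "0 \<le> s" "s \<le> 1" "2 * s = of_int c" "\<bar>t\<bar> < 1"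
  shows "(LBINT x. remove_sings (\<lambda>z. interpolation_series (node_wt s lam) (\<lambda>l. - lam * node_sgn_wt s lam l) (z - of_real s))
            (of_real x) * unit_exp (- t * x)) = interp_hat s lam t"
proof -
  have "(\<lambda>l. \<bar>- lam * node_sgn_wt s lam l\<bar> * \<bar>of_int l\<bar>) summable_on UNIV"
    using summable_on_cmult_right[OF summable_node_sgn_wt_mult[OF assms(1-3)], of lam] assms(1)
    by (simp add: abs_mult mult_ac)
  moreover have "(\<lambda>l. \<bar>- lam * node_sgn_wt s lam l\<bar>) summable_on UNIV"
    using summable_on_cmult_right[OF summable_node_sgn_wt[OF assms(1-3)], of lam] assms(1)
    by (simp add: abs_mult)
  moreover have "((\<lambda>l. - lam * node_sgn_wt s lam l) has_sum 0) UNIV"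
    using has_sum_cmult_right[OF has_sum_node_sgn_wt[OF assms(1-4)], of "- lam"] by simp
  moreover have "(\<Sum>\<^sub>\<infinity>k. complex_of_real (- lam * node_sgn_wt s lam k) * unit_exp (- t * (of_int k + s))) =
      - of_real lam * (\<Sum>\<^sub>\<infinity>k. of_real (node_sgn_wt s lam k) * unit_exp (- t * (of_int k + s)))"
    unfolding infsum_cmult_right'[symmetric] by (simp only: of_real_mult of_real_minus mult.assoc)
  ultimately show ?thesis
    using integral_remove_sings_interpolation_series[OF assms(5) summable_node_wt[OF assms(1-3)],
        of "\<lambda>l. - lam * node_sgn_wt s lam l" s]
    unfolding interp_hat_def by (simp add: field_simps)
qed

lemma M_fun_eq:
  "M_fun lam = remove_sings (\<lambda>z. interpolation_series (node_wt 0 lam) (\<lambda>l. - lam * node_sgn_wt 0 lam l) (z - of_real 0))"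
proof -
  have "(\<Sum>\<^sub>\<infinity>l. complex_of_real (- lam * node_sgn_wt 0 lam l) / (z - of_int l)) =
      - of_real lam * (\<Sum>\<^sub>\<infinity>l::int. of_real (sgn (of_int l) * exp (- lam * \<bar>of_int l\<bar>)) / (z - of_int l))" for z
    unfolding infsum_cmult_right'[symmetric] by (simp add: node_sgn_wt_def mult_ac)
  then show ?thesis
    unfolding M_fun_def interpolation_series_def by (simp add: node_wt_def)
qed

lemma L_fun_eq:
  "L_fun lam = remove_sings (\<lambda>z. interpolation_series (node_wt (1/2) lam) (\<lambda>l. - lam * node_sgn_wt (1/2) lam l) (z - of_real (1/2)))"
proof -
  have d: "z - complex_of_real (1/2) - of_int l = z - of_int l - 1/2" for z l by simp
  have "(\<Sum>\<^sub>\<infinity>l. complex_of_real (- lam * node_sgn_wt (1/2) lam l) / (z - of_real (1/2) - of_int l)) =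
      - of_real lam * (\<Sum>\<^sub>\<infinity>l::int. of_real (sgn (of_int l + 1/2) * exp (- lam * \<bar>of_int l + 1/2\<bar>)) / (z - of_int l - 1/2))" for z
    unfolding infsum_cmult_right'[symmetric] node_sgn_wt_def d by (simp add: mult_ac)
  moreover have "(\<Sum>\<^sub>\<infinity>k. complex_of_real (node_wt (1/2) lam k) / (z - of_real (1/2) - of_int k)\<^sup>2) =
      (\<Sum>\<^sub>\<infinity>k::int. of_real (exp (- lam * \<bar>of_int k + 1/2\<bar>)) / (z - of_int k - 1/2)\<^sup>2)" for z
    unfolding d by (simp add: node_wt_def)
  moreover have "(sin (of_real pi * (z - of_real (1/2))) / of_real pi)\<^sup>2 = (cos (of_real pi * z) / of_real pi)\<^sup>2" for z :: complex
  proof -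
    have "of_real pi * (z - of_real (1/2)) = - (complex_of_real pi / 2 - of_real pi * z)" by (simp add: algebra_simps)
    then have "sin (of_real pi * (z - of_real (1/2))) = - cos (of_real pi * z)"
      by (simp only: sin_minus cos_sin_eq)
    then show ?thesis by (simp add: power_divide)
  qed
  ultimately show ?thesis
    unfolding L_fun_def interpolation_series_def by simp
qed

lemma M_hat_eq: "lam > 0 \<Longrightarrow> \<bar>t\<bar> < 1 \<Longrightarrow> M_hat lam t = interp_hat 0 lam t"
  unfolding M_hat_def M_fun_eq by (rule interp_hat_eq_integral[of _ _ 0]) auto

lemma L_hat_eq: "lam > 0 \<Longrightarrow> \<bar>t\<bar> < 1 \<Longrightarrow> L_hat lam t = interp_hat (1/2) lam t"
  unfolding L_hat_def L_fun_eq by (rule interp_hat_eq_integral[of _ _ 1]) auto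

text \<open>Reflecting the grid exchanges t and -t. It changes the sign of the signed sum, which is
  offset by the factor sgn t. Conjugation also exchanges t and -t, and the sign of the imaginary
  unit compensates in the same way.\<close>

lemma interp_hat_symmetric:
  assumes "2 * s = of_int c"
  shows "interp_hat s lam (- t) = interp_hat s lam t" "cnj (interp_hat s lam t) = interp_hat s lam t"
proof -
  define A where "A t = (\<Sum>\<^sub>\<infinity>k. complex_of_real (node_wt s lam k) * unit_exp (- t * (of_int k + s)))" for t
  define B where "B t = (\<Sum>\<^sub>\<infinity>k. complex_of_real (node_sgn_wt s lam k) * unit_exp (- t * (of_int k + s)))" for t
  have A: "A (- t) = A t" for t
    unfolding A_def
    by (subst infsum_int_reflect[symmetric, where c = c], unfold node_wt_reflect[OF assms]) (simp add: algebra_simps)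
  have B: "B (- t) = - B t" for t
    unfolding B_def infsum_uminus[symmetric]
    by (subst infsum_int_reflect[symmetric, where c = c], unfold node_wt_reflect[OF assms]) (simp add: algebra_simps)
  have cnj: "cnj (A t) = A (- t)" "cnj (B t) = B (- t)" for t
    unfolding A_def B_def infsum_cnj[symmetric] by simp_all
  show "interp_hat s lam (- t) = interp_hat s lam t"
    unfolding interp_hat_def A_def[symmetric] B_def[symmetric] A B by simp
  show "cnj (interp_hat s lam t) = interp_hat s lam t"
    unfolding interp_hat_def A_def[symmetric] B_def[symmetric] by (simp add: cnj A B)
qed

section \<open>Discrete kernels on the grid of nodes\<close>

definition node_kernel :: "nat \<Rightarrow> (int \<Rightarrow> complex) \<Rightarrow> int \<Rightarrow> complex" where
  "node_kernel N c r = (\<Sum>n = - int N..int N. c n * unit_exp (of_int n * (of_int r / real (N + 1))))"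

text \<open>The frequencies \<open>n\<close> and \<open>n - (N + 1)\<close> agree at the nodes.\<close>
lemma node_kernel_eq:
  assumes v: "\<And>n. 1 \<le> n \<Longrightarrow> n \<le> int N \<Longrightarrow> c n + c (n - int (N + 1)) = v"
  shows "node_kernel N c r = c 0 - v + v * (if int (N + 1) dvd r then of_nat (N + 1) else 0)"
proof -
  define e where "e n = unit_exp (of_int n * (of_int r / real (N + 1)))" for n :: int
  have e: "e (n - int (N + 1)) = e n" for n
  proof -
    have "real_of_int (n - int (N + 1)) * (of_int r / real (N + 1)) =
        of_int n * (of_int r / real (N + 1)) + of_int (- r)"
      by (simp add: field_simps)
    then show ?thesis unfolding e_def by (simp only: unit_exp_add unit_exp_of_int mult_1_right)
  qed
  have "{- int N..int N} = insert 0 ({- int N..- 1} \<union> {1..int N})" by auto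
  then have "node_kernel N c r = c 0 * e 0 + ((\<Sum>n\<in>{- int N..- 1}. c n * e n) + (\<Sum>n\<in>{1..int N}. c n * e n))"
    unfolding node_kernel_def e_def[symmetric] by (simp add: sum.union_disjoint)
  also have "(\<Sum>n\<in>{- int N..- 1}. c n * e n) = (\<Sum>n\<in>{1..int N}. c (n - int (N + 1)) * e (n - int (N + 1)))"
    by (rule sum.reindex_bij_witness[of _ "\<lambda>n. n - int (N + 1)" "\<lambda>n. n + int (N + 1)"]) auto
  also have "\<dots> + (\<Sum>n\<in>{1..int N}. c n * e n) = (\<Sum>n\<in>{1..int N}. v * e n)"
    unfolding sum.distrib[symmetric] e by (rule sum.cong) (use v in \<open>auto simp: ring_distribs add.commute simp flip: v\<close>)
  also have "\<dots> = v * (\<Sum>n\<in>{1..int N}. e n)" by (simp add: sum_distrib_left)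
  also have "(\<Sum>n\<in>{1..int N}. e n) = (if int (N + 1) dvd r then of_nat (N + 1) else 0) - 1"
  proof -
    have "(\<Sum>n\<in>{1..int N}. e n) = (\<Sum>n\<in>{1..N}. e (int n))"
      by (rule sum.reindex_bij_witness[of _ int nat]) auto
    also have "\<dots> = (\<Sum>n<N + 1. e (int n)) - e 0"
      using sum.lessThan_Suc_shift[of "\<lambda>n. e (int n)" N] by (simp add: sum.atLeast1_atMost_eq del: sum.lessThan_Suc)
    also have "(\<Sum>n<N + 1. e (int n)) = (\<Sum>n<N + 1. unit_exp (of_int r * (real n / real (N + 1))))"
      by (simp add: e_def mult_ac)
    also have "\<dots> = (if int (N + 1) dvd r then of_nat (N + 1) else 0)"
    proof (cases "int (N + 1) dvd r")
      case True
      then obtain q where "r = int (N + 1) * q" by blast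
      then have "real_of_int r = real (N + 1) * of_int q" by (simp only: of_int_mult of_int_of_nat_eq)
      then have "of_int r * (real n / real (N + 1)) = of_int (q * int n)" for n by simp
      then have "unit_exp (of_int r * (real n / real (N + 1))) = 1" for n by (simp only: unit_exp_of_int)
      then show ?thesis using True by simp
    qed (use sum_unit_exp_eq_0[of "N + 1" r] in simp)
    finally show ?thesis by (simp add: e_def)
  qed
  finally show ?thesis by (simp add: e_def algebra_simps)
qed

text \<open>Without summability both sides take the default value 0.\<close>

lemma infsum_complex_of_real: "(\<Sum>\<^sub>\<infinity>x\<in>A. complex_of_real (f x)) = of_real (infsum f A)"
proof (cases "f summable_on A")
  case True
  then show ?thesis by (intro infsumI has_sum_of_real has_sum_infsum)
next
  case False
  moreover have "\<not> (\<lambda>x. complex_of_real (f x)) summable_on A"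
    using False summable_on_Re[of "\<lambda>x. complex_of_real (f x)" A] by auto
  ultimately show ?thesis by (simp add: infsum_not_exists)
qed

lemma infsum_residue_class:
  fixes w :: "int \<Rightarrow> complex"
  assumes "K > 0"
  shows "(\<Sum>\<^sub>\<infinity>k. w k * (if K dvd j - k then v else 0)) = v * (\<Sum>\<^sub>\<infinity>m. w (j + m * K))"
proof -
  have "(\<Sum>\<^sub>\<infinity>k. w k * (if K dvd j - k then v else 0)) = (\<Sum>\<^sub>\<infinity>k\<in>range (\<lambda>m. j + m * K). v * w k)"
  proof (rule infsum_cong_neutral)
    fix k
    assume "k \<in> UNIV - range (\<lambda>m. j + m * K)"
    moreover have "k \<in> range (\<lambda>m. j + m * K)" if "K dvd j - k"
    proof -
      from that obtain q where "j - k = K * q" by blast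
      then have "k = j + (- q) * K" by (simp add: algebra_simps)
      then show ?thesis by blast
    qed
    ultimately show "w k * (if K dvd j - k then v else 0) = 0" by auto
  qed auto
  also have "\<dots> = (\<Sum>\<^sub>\<infinity>m. v * w (j + m * K))"
    using assms by (subst infsum_reindex) (auto simp: inj_on_def o_def)
  finally show ?thesis by (simp add: infsum_cmult_right')
qed

lemma has_sum_finite_sum:
  fixes f :: "'i \<Rightarrow> 'k \<Rightarrow> 'a :: topological_comm_monoid_add"
  assumes "\<And>i. i \<in> I \<Longrightarrow> (f i has_sum S i) A"
  shows "((\<lambda>k. \<Sum>i\<in>I. f i k) has_sum (\<Sum>i\<in>I. S i)) A"
  using assms by (induction I rule: infinite_finite_induct) (auto intro: has_sum_add)

lemma sum_infsum_node_kernel: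
  fixes w :: "int \<Rightarrow> real"
  assumes w: "(\<lambda>k. \<bar>w k\<bar>) summable_on UNIV"
  shows "(\<Sum>n = - int N..int N. c n * (\<Sum>\<^sub>\<infinity>k. of_real (w k) * unit_exp (- (of_int n / real (N + 1)) * (of_int k + s)))
            * unit_exp (of_int n * ((of_int j + s) / real (N + 1)))) =
         (\<Sum>\<^sub>\<infinity>k. of_real (w k) * node_kernel N c (j - k))"
    and "(\<lambda>k. of_real (w k) * node_kernel N c (j - k)) summable_on UNIV"
proof -
  define f where "f n k = complex_of_real (w k) * (c n * unit_exp (of_int n * (of_int (j - k) / real (N + 1))))" for n k
  have sum: "f n summable_on UNIV" for n
    by (rule abs_summable_summable)
       (use summable_on_cmult_left[OF w, of "norm (c n)"] in \<open>simp add: f_def norm_mult\<close>)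
  have "c n * (\<Sum>\<^sub>\<infinity>k. of_real (w k) * unit_exp (- (of_int n / real (N + 1)) * (of_int k + s)))
       * unit_exp (of_int n * ((of_int j + s) / real (N + 1))) = infsum (f n) UNIV" for n
    unfolding infsum_cmult_right'[symmetric] infsum_cmult_left'[symmetric]
  proof (rule infsum_cong)
    fix k
    \<comment> \<open>The offset \<open>s\<close> of the sample points cancels against that of the
      node, so the kernel depends only on j - k.\<close>
    have "- (x / K) * (y + s) + x * ((z + s) / K) = x * ((z - y) / K)" for x y z K :: real
      by (cases "K = 0") (simp_all add: field_simps)
    then have "- (of_int n / real (N + 1)) * (of_int k + s) + of_int n * ((of_int j + s) / real (N + 1)) =
        of_int n * (of_int (j - k) / real (N + 1))" by simp
    then have "unit_exp (- (of_int n / real (N + 1)) * (of_int k + s)) * unit_exp (of_int n * ((of_int j + s) / real (N + 1))) =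
        unit_exp (of_int n * (of_int (j - k) / real (N + 1)))"
      by (simp only: unit_exp_add[symmetric])
    then show "c n * (of_real (w k) * unit_exp (- (of_int n / real (N + 1)) * (of_int k + s))) *
        unit_exp (of_int n * ((of_int j + s) / real (N + 1))) = f n k"
      unfolding f_def by (metis mult.assoc mult.left_commute)
  qed
  moreover have *: "of_real (w k) * node_kernel N c (j - k) = (\<Sum>n = - int N..int N. f n k)" for k
    by (simp add: node_kernel_def f_def sum_distrib_left)
  have "((\<lambda>k. \<Sum>n = - int N..int N. f n k) has_sum (\<Sum>n = - int N..int N. infsum (f n) UNIV)) UNIV"
    by (intro has_sum_finite_sum has_sum_infsum sum)
  ultimately show "(\<Sum>n = - int N..int N. c n * (\<Sum>\<^sub>\<infinity>k. of_real (w k) * unit_exp (- (of_int n / real (N + 1)) * (of_int k + s)))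
            * unit_exp (of_int n * ((of_int j + s) / real (N + 1)))) =
         (\<Sum>\<^sub>\<infinity>k. of_real (w k) * node_kernel N c (j - k))"
     "(\<lambda>k. of_real (w k) * node_kernel N c (j - k)) summable_on UNIV"
    unfolding * by (auto simp: infsumI summable_on_def)
qed

definition trig_interp :: "real \<Rightarrow> real \<Rightarrow> nat \<Rightarrow> real \<Rightarrow> complex" where
  "trig_interp s lam N x = 1 / of_nat (N + 1) *
     (\<Sum>n = - int N..int N. interp_hat s (lam / real (N + 1)) (of_int n / real (N + 1)) * unit_exp (of_int n * x))"

lemma node_abs_lt_1: "n \<in> {- int N..int N} \<Longrightarrow> \<bar>of_int n / real (N + 1)\<bar> < 1"
  by auto

lemma l_poly_eq: "lam > 0 \<Longrightarrow> l_poly lam N x = - of_real (2 / lam) + trig_interp (1/2) lam N x"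
  unfolding l_poly_def trig_interp_def
  by (intro arg_cong2[of _ _ _ _ "(+)"] arg_cong2[of _ _ _ _ "(*)"] sum.cong refl L_hat_eq node_abs_lt_1) auto

lemma m_poly_eq: "lam > 0 \<Longrightarrow> m_poly lam N x = - of_real (2 / lam) + trig_interp 0 lam N x"
  unfolding m_poly_def trig_interp_def
  by (intro arg_cong2[of _ _ _ _ "(+)"] arg_cong2[of _ _ _ _ "(*)"] sum.cong refl M_hat_eq node_abs_lt_1) auto

text \<open>The multiplier \<open>d\<close> is 1 for the values of the polynomial and 2 pi i n for
  its derivative.\<close>

lemma sum_interp_hat_at_node:
  fixes lam :: real and N :: nat and d :: "int \<Rightarrow> complex"
  defines "mu \<equiv> lam / real (N + 1)"
  assumes lam: "lam > 0" "0 \<le> s" "s \<le> 1"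
  shows "(\<Sum>n = - int N..int N. d n * interp_hat s mu (of_int n / real (N + 1)) * unit_exp (of_int n * ((of_int j + s) / real (N + 1)))) =
    (\<Sum>\<^sub>\<infinity>k. of_real (node_wt s mu k) * node_kernel N (\<lambda>n. d n * of_real (1 - \<bar>of_int n / real (N + 1)\<bar>)) (j - k)) +
    \<i> * of_real (mu / (2 * pi)) * (\<Sum>\<^sub>\<infinity>k. of_real (node_sgn_wt s mu k) * node_kernel N (\<lambda>n. d n * of_int (sgn n)) (j - k))"
proof -
  have mu: "mu > 0" using lam by (simp add: mu_def)
  define A where "A n = (\<Sum>\<^sub>\<infinity>k. of_real (node_wt s mu k) * unit_exp (- (of_int n / real (N + 1)) * (of_int k + s)))" for n :: int
  define B where "B n = (\<Sum>\<^sub>\<infinity>k. of_real (node_sgn_wt s mu k) * unit_exp (- (of_int n / real (N + 1)) * (of_int k + s)))" for n :: int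
  define e where "e n = unit_exp (of_int n * ((of_int j + s) / real (N + 1)))" for n :: int
  have "sgn (of_int n / real (N + 1)) = of_int (sgn n)" for n :: int
  proof -
    have "sgn (of_int n / real (N + 1)) = sgn (real_of_int n)" by (simp add: sgn_divide)
    then show ?thesis by (simp add: sgn_if)
  qed
  then have "d n * interp_hat s mu (of_int n / real (N + 1)) * e n =
      d n * of_real (1 - \<bar>of_int n / real (N + 1)\<bar>) * A n * e n +
      \<i> * of_real (mu / (2 * pi)) * (d n * of_int (sgn n) * B n * e n)" for n
    unfolding interp_hat_def A_def B_def by (simp add: algebra_simps)
  then have "(\<Sum>n = - int N..int N. d n * interp_hat s mu (of_int n / real (N + 1)) * e n) =
      (\<Sum>n = - int N..int N. d n * of_real (1 - \<bar>of_int n / real (N + 1)\<bar>) * A n * e n) +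
      \<i> * of_real (mu / (2 * pi)) * (\<Sum>n = - int N..int N. d n * of_int (sgn n) * B n * e n)"
    by (simp only: sum.distrib sum_distrib_left)
  then show ?thesis
    unfolding A_def B_def e_def
      sum_infsum_node_kernel(1)[OF summable_node_wt[OF mu lam(2,3)], where c = "\<lambda>n. d n * of_real (1 - \<bar>of_int n / real (N + 1)\<bar>)"]
      sum_infsum_node_kernel(1)[OF summable_node_sgn_wt[OF mu lam(2,3)], where c = "\<lambda>n. d n * of_int (sgn n)"] .
qed

text \<open>Rescaling by N + 1 turns the weights along a residue class into the terms of the
  periodization at a node; this is how p and its derivative appear.\<close>

lemma node_wt_residue_class:
  "node_wt s (lam / real (N + 1)) (j + m * int (N + 1)) = exp (- lam * \<bar>(of_int j + s) / real (N + 1) + of_int m\<bar>)"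
  "node_sgn_wt s (lam / real (N + 1)) (j + m * int (N + 1)) =
     sgn ((of_int j + s) / real (N + 1) + of_int m) * exp (- lam * \<bar>(of_int j + s) / real (N + 1) + of_int m\<bar>)"
proof -
  have *: "of_int (j + m * int (N + 1)) + s = real (N + 1) * ((of_int j + s) / real (N + 1) + of_int m)"
    by (simp add: field_simps)
  have "\<bar>of_int (j + m * int (N + 1)) + s\<bar> = real (N + 1) * \<bar>(of_int j + s) / real (N + 1) + of_int m\<bar>"
    unfolding * abs_mult by simp
  moreover have "sgn (of_int (j + m * int (N + 1)) + s) = sgn ((of_int j + s) / real (N + 1) + of_int m)"
    unfolding * sgn_mult by simp
  moreover have "- (lam / real (N + 1)) * (real (N + 1) * y) = - lam * y" for y by simp
  ultimately show "node_wt s (lam / real (N + 1)) (j + m * int (N + 1)) = exp (- lam * \<bar>(of_int j + s) / real (N + 1) + of_int m\<bar>)"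
  "node_sgn_wt s (lam / real (N + 1)) (j + m * int (N + 1)) =
     sgn ((of_int j + s) / real (N + 1) + of_int m) * exp (- lam * \<bar>(of_int j + s) / real (N + 1) + of_int m\<bar>)"
    unfolding node_wt_def node_sgn_wt_def by (simp_all only:)
qed

lemma node_abs:
  assumes "1 \<le> n" "n \<le> int N"
  shows "\<bar>of_int n / real (N + 1)\<bar> = of_int n / real (N + 1)"
    and "\<bar>of_int (n - int (N + 1)) / real (N + 1)\<bar> = 1 - of_int n / real (N + 1)"
proof -
  show "\<bar>of_int n / real (N + 1)\<bar> = of_int n / real (N + 1)" using assms by simp
  have "of_int n \<le> real (N + 1)" using assms(2) by linarith
  then have "of_int n / real (N + 1) \<le> 1" by simp
  moreover have "of_int (n - int (N + 1)) / real (N + 1) = of_int n / real (N + 1) - 1"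
    by (simp add: field_simps)
  ultimately show "\<bar>of_int (n - int (N + 1)) / real (N + 1)\<bar> = 1 - of_int n / real (N + 1)" by linarith
qed

text \<open>The triangular coefficients of paired frequencies add up to 1, so their kernel is N + 1
  times the indicator of divisibility by N + 1. The coefficients sgn n cancel in pairs and
  contribute nothing.\<close>

lemma trig_interp_at_node:
  assumes lam: "lam > 0" "0 \<le> s" "s \<le> 1"
  shows "trig_interp s lam N ((of_int j + s) / real (N + 1)) =
    of_real (\<Sum>\<^sub>\<infinity>m::int. exp (- lam * \<bar>(of_int j + s) / real (N + 1) + of_int m\<bar>))"
proof -
  define mu where "mu = lam / real (N + 1)"
  have 1: "node_kernel N (\<lambda>n. 1 * of_real (1 - \<bar>of_int n / real (N + 1)\<bar>)) r = (if int (N + 1) dvd r then of_nat (N + 1) else 0)" for r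
  proof (subst node_kernel_eq[where v = 1])
    fix n assume n: "1 \<le> n" "n \<le> int N"
    have "(1 - \<bar>of_int n / real (N + 1)\<bar>) + (1 - \<bar>of_int (n - int (N + 1)) / real (N + 1)\<bar>) = 1"
      unfolding node_abs[OF n] by simp
    then show "1 * complex_of_real (1 - \<bar>of_int n / real (N + 1)\<bar>) +
       1 * complex_of_real (1 - \<bar>of_int (n - int (N + 1)) / real (N + 1)\<bar>) = 1"
      by (metis mult_1 of_real_1 of_real_add)
  qed simp
  have 2: "node_kernel N (\<lambda>n. 1 * of_int (sgn n)) r = 0" for r
    by (subst node_kernel_eq[where v = 0]) auto
  have "(\<Sum>n = - int N..int N. 1 * interp_hat s mu (of_int n / real (N + 1)) * unit_exp (of_int n * ((of_int j + s) / real (N + 1)))) =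
    of_nat (N + 1) * (\<Sum>\<^sub>\<infinity>m. of_real (node_wt s mu (j + m * int (N + 1))))"
    unfolding sum_interp_hat_at_node[OF lam, where N = N, folded mu_def] 1 2
    by (subst infsum_residue_class) auto
  also have "\<dots> = of_nat (N + 1) * of_real (\<Sum>\<^sub>\<infinity>m::int. exp (- lam * \<bar>(of_int j + s) / real (N + 1) + of_int m\<bar>))"
    unfolding mu_def node_wt_residue_class infsum_complex_of_real ..
  finally show ?thesis by (simp add: trig_interp_def mu_def del: of_nat_Suc)
qed

text \<open>With the factor n the roles are exchanged: n(1 - n/(N + 1)) cancels against its partner,
  while n sgn n and its partner add up to N + 1.\<close>

lemma sum_interp_hat_derivative_at_node:
  fixes lam :: real and N :: nat
  defines "mu \<equiv> lam / real (N + 1)"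
  assumes lam: "lam > 0" "0 \<le> s" "s \<le> 1" and c: "2 * s = of_int c"
  shows "(\<Sum>n = - int N..int N. 2 * of_real pi * \<i> * of_int n * interp_hat s mu (of_int n / real (N + 1)) *
      unit_exp (of_int n * ((of_int j + s) / real (N + 1)))) =
    of_nat (N + 1) * of_real (- lam * (\<Sum>\<^sub>\<infinity>m::int. sgn ((of_int j + s) / real (N + 1) + of_int m) *
      exp (- lam * \<bar>(of_int j + s) / real (N + 1) + of_int m\<bar>)))"
proof -
  have mu: "mu > 0" using lam by (simp add: mu_def)
  define \<kappa> where "\<kappa> = 2 * complex_of_real pi * \<i> * of_nat (N + 1)"
  define S where "S = (\<Sum>\<^sub>\<infinity>m::int. sgn ((of_int j + s) / real (N + 1) + of_int m) *
      exp (- lam * \<bar>(of_int j + s) / real (N + 1) + of_int m\<bar>))"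
  have 1: "node_kernel N (\<lambda>n. 2 * of_real pi * \<i> * of_int n * of_real (1 - \<bar>of_int n / real (N + 1)\<bar>)) r = 0" for r
  proof (subst node_kernel_eq[where v = 0])
    fix n assume n: "1 \<le> n" "n \<le> int N"
    have "of_int n * (1 - of_int n / real (N + 1)) + of_int (n - int (N + 1)) * (1 - (1 - of_int n / real (N + 1))) = 0"
      by (simp add: field_simps)
    then have "of_int n * (1 - \<bar>of_int n / real (N + 1)\<bar>) + of_int (n - int (N + 1)) * (1 - \<bar>of_int (n - int (N + 1)) / real (N + 1)\<bar>) = 0"
      unfolding node_abs[OF n] .
    then have "2 * complex_of_real pi * \<i> * of_real (of_int n * (1 - \<bar>of_int n / real (N + 1)\<bar>) +
        of_int (n - int (N + 1)) * (1 - \<bar>of_int (n - int (N + 1)) / real (N + 1)\<bar>)) = 0"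
      by (simp only: of_real_0 mult_zero_right)
    then show "2 * complex_of_real pi * \<i> * of_int n * of_real (1 - \<bar>of_int n / real (N + 1)\<bar>) +
        2 * complex_of_real pi * \<i> * of_int (n - int (N + 1)) * of_real (1 - \<bar>of_int (n - int (N + 1)) / real (N + 1)\<bar>) = 0"
      by (simp only: of_real_add of_real_mult of_real_of_int_eq distrib_left mult.assoc)
  qed simp
  have 2: "node_kernel N (\<lambda>n. 2 * of_real pi * \<i> * of_int n * of_int (sgn n)) r =
      - \<kappa> + (if int (N + 1) dvd r then \<kappa> * of_nat (N + 1) else 0)" for r
  proof (subst node_kernel_eq[where v = \<kappa>])
    fix n assume n: "1 \<le> n" "n \<le> int N"
    then have "sgn n = 1" "sgn (n - int (N + 1)) = - 1" by (auto simp: sgn_if)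
    then show "2 * of_real pi * \<i> * of_int n * of_int (sgn n) +
        2 * of_real pi * \<i> * of_int (n - int (N + 1)) * of_int (sgn (n - int (N + 1))) = \<kappa>"
      by (simp add: \<kappa>_def algebra_simps)
  qed simp
  define b where "b k = complex_of_real (node_sgn_wt s mu k)" for k
  have "(\<lambda>k. b k * (- \<kappa> + (if int (N + 1) dvd j - k then \<kappa> * of_nat (N + 1) else 0))) summable_on UNIV"
    using sum_infsum_node_kernel(2)[OF summable_node_sgn_wt[OF mu lam(2,3)], of N "\<lambda>n. 2 * of_real pi * \<i> * of_int n * of_int (sgn n)" j]
    unfolding 2 b_def .
  then have *: "((\<lambda>k. b k * (- \<kappa> + (if int (N + 1) dvd j - k then \<kappa> * of_nat (N + 1) else 0))) has_sum
      (\<Sum>\<^sub>\<infinity>k. b k * (- \<kappa> + (if int (N + 1) dvd j - k then \<kappa> * of_nat (N + 1) else 0)))) UNIV"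
    by (rule has_sum_infsum)
  \<comment> \<open>The frequency 0 has coefficient 0 instead of the common value, which leaves the
    constant -\<kappa> in the kernel. It drops out because the signed weights sum to 0.\<close>
  have "((\<lambda>k. b k * \<kappa>) has_sum (of_real 0 * \<kappa>)) UNIV"
    unfolding b_def by (intro has_sum_cmult_left has_sum_of_real has_sum_node_sgn_wt[OF mu lam(2,3) c])
  from has_sum_add[OF * this]
  have "(\<Sum>\<^sub>\<infinity>k. b k * (- \<kappa> + (if int (N + 1) dvd j - k then \<kappa> * of_nat (N + 1) else 0))) =
     (\<Sum>\<^sub>\<infinity>k. b k * (if int (N + 1) dvd j - k then \<kappa> * of_nat (N + 1) else 0))"
    by (intro infsumI[symmetric]) (simp add: algebra_simps)
  also have "\<dots> = \<kappa> * of_nat (N + 1) * of_real S"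
  proof -
    have "int (N + 1) > 0" by simp
    show ?thesis
      unfolding infsum_residue_class[OF \<open>int (N + 1) > 0\<close>] b_def mu_def S_def node_wt_residue_class infsum_complex_of_real ..
  qed
  finally have "(\<Sum>\<^sub>\<infinity>k. b k * (- \<kappa> + (if int (N + 1) dvd j - k then \<kappa> * of_nat (N + 1) else 0))) =
      \<kappa> * of_nat (N + 1) * of_real S" .
  then have "(\<Sum>n = - int N..int N. 2 * of_real pi * \<i> * of_int n * interp_hat s mu (of_int n / real (N + 1)) *
      unit_exp (of_int n * ((of_int j + s) / real (N + 1)))) =
      \<i> * of_real (mu / (2 * pi)) * (\<kappa> * of_nat (N + 1) * of_real S)"
    unfolding sum_interp_hat_at_node[OF lam, where N = N, folded mu_def] 1 2 b_def by simp
  also have "\<dots> = of_nat (N + 1) * of_real (- lam * S)"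
    by (simp add: \<kappa>_def mu_def field_simps del: of_nat_Suc)
  finally show ?thesis unfolding S_def .
qed

text \<open>The coefficients are real and even, which makes the sum real valued and even; evenness
  gives the vanishing slope at 0 on which both comparison lemmas rely.\<close>

lemma trig_interp_real:
  assumes lam: "lam > 0" "0 \<le> s" "s \<le> 1" and c: "2 * s = of_int c"
  obtains T T1 where
    "real_trig_poly N T" "\<And>x. (T has_real_derivative T1 x) (at x)" "\<And>x. trig_interp s lam N x = of_real (T x)"
    "T1 0 = 0"
    "\<And>j. T ((of_int j + s) / real (N + 1)) = (\<Sum>\<^sub>\<infinity>m::int. exp (- lam * \<bar>(of_int j + s) / real (N + 1) + of_int m\<bar>))"
    "\<And>j. T1 ((of_int j + s) / real (N + 1)) = - lam * (\<Sum>\<^sub>\<infinity>m::int. sgn ((of_int j + s) / real (N + 1) + of_int m) *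
         exp (- lam * \<bar>(of_int j + s) / real (N + 1) + of_int m\<bar>))"
proof -
  define h where "h n = interp_hat s (lam / real (N + 1)) (of_int n / real (N + 1))" for n :: int
  have h: "h (- n) = h n" "cnj (h n) = h n" for n
    using interp_hat_symmetric[OF c] by (simp_all add: h_def)
  have ti: "trig_interp s lam N x = 1 / of_nat (N + 1) * (\<Sum>n = - int N..int N. h n * unit_exp (of_int n * x))" for x
    by (simp add: trig_interp_def h_def)
  have even: "trig_interp s lam N (- x) = trig_interp s lam N x" for x
  proof -
    have "(\<Sum>n = - int N..int N. h n * unit_exp (of_int n * (- x))) = (\<Sum>n = - int N..int N. h n * unit_exp (of_int n * x))"
      by (rule sum.reindex_bij_witness[of _ uminus uminus]) (auto simp: h)
    then show ?thesis by (simp only: ti)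
  qed
  have "cnj (trig_interp s lam N x) = trig_interp s lam N (- x)" for x
    by (simp add: ti h)
  then have real: "trig_interp s lam N x = of_real (Re (trig_interp s lam N x))" for x
    by (metis even complex_cnj_cancel_iff Reals_cnj_iff of_real_Re)
  define T where "T x = Re (trig_interp s lam N x)" for x
  have T: "trig_interp s lam N x = of_real (T x)" for x unfolding T_def by (rule real)
  have rtp: "real_trig_poly N T"
    unfolding real_trig_poly_def T[symmetric] ti
    by (rule exI[of _ "\<lambda>n. 1 / of_nat (N + 1) * h n"]) (simp add: sum_distrib_left mult_ac)
  obtain T1 where T1: "\<And>x. (T has_real_derivative T1 x) (at x)"
    using real_trig_poly_derivative[OF rtp] by blast
  have T1_eq: "of_real (T1 x) = 1 / of_nat (N + 1) * (\<Sum>n = - int N..int N. 2 * of_real pi * \<i> * of_int n * h n * unit_exp (of_int n * x))" for x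
  proof (rule vector_derivative_unique_at)
    show "(trig_interp s lam N has_vector_derivative of_real (T1 x)) (at x)"
      unfolding T[abs_def] using T1[of x]
      by (intro has_vector_derivative_of_real) (simp add: has_real_derivative_iff_has_vector_derivative)
    show "(trig_interp s lam N has_vector_derivative
        1 / of_nat (N + 1) * (\<Sum>n = - int N..int N. 2 * of_real pi * \<i> * of_int n * h n * unit_exp (of_int n * x))) (at x)"
      unfolding ti[abs_def]
      by (rule derivative_eq_intros has_vector_derivative_unit_exp refl | simp add: mult_ac)+
  qed
  have "T1 0 = 0"
  proof -
    have "T (- x) = T x" for x using even[of x] by (simp add: T)
    moreover have "((\<lambda>x. T (- x)) has_real_derivative T1 (- 0) * (- 1)) (at 0)"
      by (rule DERIV_chain2[OF T1]) (auto intro!: derivative_eq_intros)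
    ultimately have "(T has_real_derivative - T1 0) (at 0)" by simp
    from DERIV_unique[OF this T1] show ?thesis by simp
  qed
  moreover have "T ((of_int j + s) / real (N + 1)) = (\<Sum>\<^sub>\<infinity>m::int. exp (- lam * \<bar>(of_int j + s) / real (N + 1) + of_int m\<bar>))" for j
    using trig_interp_at_node[OF lam, of N j] unfolding T of_real_eq_iff .
  moreover have "T1 ((of_int j + s) / real (N + 1)) = - lam * (\<Sum>\<^sub>\<infinity>m::int. sgn ((of_int j + s) / real (N + 1) + of_int m) *
         exp (- lam * \<bar>(of_int j + s) / real (N + 1) + of_int m\<bar>))" for j
  proof -
    have "complex_of_real (T1 ((of_int j + s) / real (N + 1))) = of_real (- lam * (\<Sum>\<^sub>\<infinity>m::int. sgn ((of_int j + s) / real (N + 1) + of_int m) *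
         exp (- lam * \<bar>(of_int j + s) / real (N + 1) + of_int m\<bar>)))"
      unfolding T1_eq h_def sum_interp_hat_derivative_at_node[OF lam c] by (simp del: of_nat_Suc)
    then show ?thesis unfolding of_real_eq_iff .
  qed
  ultimately show thesis using that[OF rtp T1 T] by blast
qed

section \<open>Extremality\<close>

lemma real_trig_poly_const: "real_trig_poly N (\<lambda>_. a)"
  unfolding real_trig_poly_def
proof (intro exI allI)
  have "(\<Sum>n = - int N..int N. (if n = 0 then of_real a else 0) * unit_exp (of_int n * x)) =
     (\<Sum>n = - int N..int N. if n = 0 then of_real a else 0)" for x
    by (intro sum.cong) auto
  then show "complex_of_real a = (\<Sum>n = - int N..int N. (if n = 0 then of_real a else 0) * unit_exp (of_int n * x))" for x
    by simp
qed

text \<open>\<open>sg\<close> is 1 for minorants \<open>F\<close> and -1 for majorants. At the nodes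
  \<open>d\<close> equals \<open>sg\<close> times p - F, so quadrature gives the inequality. In case
  of equality \<open>F\<close> touches p at every node, and tangency there makes the zeros of
  \<open>d\<close> double except possibly at node 0.\<close>

lemma interpolant_extremal:
  fixes s :: real and sg :: real
  assumes lam: "lam > 0" and s: "0 \<le> s" "s < 1" and T: "real_trig_poly N T"
    and T1: "\<And>x. (T has_real_derivative T1 x) (at x)"
    and node: "\<And>j. j \<le> N \<Longrightarrow> T ((real j + s) / real (N + 1)) = p_fun lam ((real j + s) / real (N + 1))"
    and node1: "\<And>j. 1 \<le> j \<Longrightarrow> j \<le> N \<Longrightarrow>
        T1 ((real j + s) / real (N + 1)) = - lam * sinh_profile lam ((real j + s) / real (N + 1))"
    and F: "real_trig_poly N F" and sg: "sg \<noteq> 0" and le: "\<And>x. sg * (p_fun lam x - F x) \<ge> 0"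
  shows "sg * (circle_integral T - circle_integral F) \<ge> 0"
    and "circle_integral F = circle_integral T \<longleftrightarrow> (\<forall>x. F x = T x)"
proof -
  define d where "d x = sg * T x + (- sg) * F x" for x
  have d: "real_trig_poly N d" unfolding d_def by (rule real_trig_poly_lincomb[OF T F])
  have int_d: "circle_integral d = sg * (circle_integral T - circle_integral F)"
    unfolding circle_integral_eq_quadrature[OF d, of s] circle_integral_eq_quadrature[OF T, of s]
      circle_integral_eq_quadrature[OF F, of s]
    by (simp add: d_def sum_distrib_left sum_subtractf right_diff_distrib flip: diff_divide_distrib)
  have d_node: "d ((real j + s) / real (N + 1)) =
      sg * (p_fun lam ((real j + s) / real (N + 1)) - F ((real j + s) / real (N + 1)))" if "j \<le> N" for j
    unfolding d_def node[OF that] by (simp add: algebra_simps)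
  have d_nonneg: "d ((real j + s) / real (N + 1)) \<ge> 0" if "j \<le> N" for j
    unfolding d_node[OF that] by (rule le)
  show "sg * (circle_integral T - circle_integral F) \<ge> 0"
    using nonneg_at_nodes_imp_circle_integral_nonneg(1)[OF d d_nonneg] int_d by simp
  show "circle_integral F = circle_integral T \<longleftrightarrow> (\<forall>x. F x = T x)"
  proof
    assume "circle_integral F = circle_integral T"
    then have d0: "d ((real j + s) / real (N + 1)) = 0" if "j \<le> N" for j
      using nonneg_at_nodes_imp_circle_integral_nonneg(2)[OF d d_nonneg] int_d that by simp
    obtain F1 where F1: "\<And>x. (F has_real_derivative F1 x) (at x)"
      using real_trig_poly_derivative[OF F] by blast
    have d1: "(d has_real_derivative sg * T1 x + (- sg) * F1 x) (at x)" for x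
      unfolding d_def[abs_def] by (intro DERIV_add DERIV_cmult T1 F1)
    have "d x = 0" for x
    proof (rule real_trig_poly_eq_0_of_double_zeros[OF d d1 d0])
      fix j assume j: "1 \<le> j" "j \<le> N"
      define y where "y = (real j + s) / real (N + 1)"
      have y: "0 < y" "y < 1" using j s by (auto simp: y_def)
      \<comment> \<open>The one-sided approximation \<open>F\<close> touches \<open>p\<close> at the node, hence is tangent to it.\<close>
      define g where "g x = sg * (- (2 / lam) + cosh_profile lam x - F x)" for x
      have g: "g x = sg * (p_fun lam x - F x)" if "0 \<le> x" "x \<le> 1" for x
        using p_fun_eq_cosh_profile[OF lam that] by (simp add: g_def)
      have "(g has_real_derivative sg * (0 + - lam * sinh_profile lam y - F1 y)) (at y)"
        unfolding g_def[abs_def]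
        by (intro DERIV_cmult DERIV_diff DERIV_add DERIV_const has_real_derivative_cosh_profile F1)
      moreover have "0 < min y (1 - y)" using y by simp
      moreover have "\<forall>z. \<bar>y - z\<bar> < min y (1 - y) \<longrightarrow> g y \<le> g z"
      proof (intro allI impI)
        fix z assume "\<bar>y - z\<bar> < min y (1 - y)"
        then have "0 \<le> z" "z \<le> 1" by auto
        moreover have "g y = 0" using g[of y] y d0[OF j(2)] d_node[OF j(2)] by (simp add: y_def)
        ultimately show "g y \<le> g z" using g[of z] le[of z] by simp
      qed
      ultimately have "sg * (0 + - lam * sinh_profile lam y - F1 y) = 0" by (rule DERIV_local_min)
      then show "sg * T1 ((real j + s) / real (N + 1)) + - sg * F1 ((real j + s) / real (N + 1)) = 0"
        using node1[OF j] by (simp add: y_def algebra_simps)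
    qed
    then show "\<forall>x. F x = T x" using sg by (simp add: d_def)
  next
    assume "\<forall>x. F x = T x"
    then have "F = T" by blast
    then show "circle_integral F = circle_integral T" by simp
  qed
qed

lemma card_nodes: "card ((\<lambda>j. (real j + s) / real (N + 1)) ` A) = card A"
  by (rule card_image) (auto simp: inj_on_def)

text \<open>\<open>R\<close> stands for the order or its converse, so that minorant and majorant are
  extended by periodicity alike.\<close>

lemma le_p_fun_of_unit_interval:
  assumes T: "real_trig_poly N T" and "\<And>x. 0 \<le> x \<Longrightarrow> x \<le> 1 \<Longrightarrow> R (T x) (p_fun lam x)"
  shows "R (T x) (p_fun lam x)"
proof -
  have "0 \<le> frac x" "frac x \<le> 1" using frac_lt_1[of x] by auto
  then have "R (T (frac x)) (p_fun lam (frac x))" by (rule assms(2))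
  moreover have "T (frac x) = T x" "p_fun lam (frac x) = p_fun lam x"
    using real_trig_poly_periodic[OF T, of "frac x" "\<lfloor>x\<rfloor>"] p_fun_periodic[of lam "frac x" "\<lfloor>x\<rfloor>"]
    by (simp_all add: frac_def)
  ultimately show ?thesis by simp
qed

text \<open>Writing \<open>real j + 0\<close> keeps the offset s = 0 visible, in the form in which
  \<open>interpolant_extremal\<close> expects the nodes. The slope is matched only from j = 1 on,
  since node 0 is the corner.\<close>

lemma m_poly_interpolant:
  assumes lam: "lam > 0"
  obtains T T1 where "real_trig_poly N T" "\<And>x. (T has_real_derivative T1 x) (at x)"
    "\<And>x. m_poly lam N x = of_real (T x)" "\<And>x. p_fun lam x \<le> T x"
    "\<And>j::nat. T ((real j + 0) / real (N + 1)) = p_fun lam ((real j + 0) / real (N + 1))"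
    "\<And>j. 1 \<le> j \<Longrightarrow> j \<le> N \<Longrightarrow> T1 ((real j + 0) / real (N + 1)) = - lam * sinh_profile lam ((real j + 0) / real (N + 1))"
proof -
  obtain T T1 where T: "real_trig_poly N T" "\<And>x. (T has_real_derivative T1 x) (at x)"
    "\<And>x. trig_interp 0 lam N x = of_real (T x)" "T1 0 = 0"
    and node: "\<And>j. T ((of_int j + 0) / real (N + 1)) = (\<Sum>\<^sub>\<infinity>m::int. exp (- lam * \<bar>(of_int j + 0) / real (N + 1) + of_int m\<bar>))"
    and node1: "\<And>j. T1 ((of_int j + 0) / real (N + 1)) = - lam * (\<Sum>\<^sub>\<infinity>m::int. sgn ((of_int j + 0) / real (N + 1) + of_int m) *
         exp (- lam * \<bar>(of_int j + 0) / real (N + 1) + of_int m\<bar>))"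
    using trig_interp_real[OF lam, of 0 0 N] by auto
  have T_node: "T ((real j + 0) / real (N + 1)) = 2 / lam + p_fun lam ((real j + 0) / real (N + 1))" for j
    using node[of "int j"] by (simp add: p_fun_def)
  have nd: "0 < (real j + 0) / real (N + 1)" "(real j + 0) / real (N + 1) < 1" if "1 \<le> j" "j \<le> N" for j
    using that by auto
  have T1_node: "T1 ((real j + 0) / real (N + 1)) = - lam * sinh_profile lam ((real j + 0) / real (N + 1))" if "1 \<le> j" "j \<le> N" for j
    using node1[of "int j"] infsumI[OF has_sum_sgn_exp_abs[OF lam nd[OF that]]] by simp
  define D where "D = (\<lambda>j. (real j + 0) / real (N + 1)) ` {1..N}"
  have "cosh_profile lam x \<le> T x" if x: "0 \<le> x" "x \<le> 1" for x
  proof (rule cosh_profile_le_interpolant[OF lam T(1,2) _ _ T(4) _ _ _ _ _ x])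
    \<comment> \<open>The end points 0 and 1 are the nodes with j = 0 and j = N + 1.\<close>
    show "T 0 = cosh_profile lam 0" "T 1 = cosh_profile lam 1"
      using T_node[of 0] T_node[of "N + 1"] p_fun_eq_cosh_profile[OF lam, of 0] p_fun_eq_cosh_profile[OF lam, of 1] by simp_all
    show "finite D" "card D = N" unfolding D_def card_nodes by simp_all
    show "D \<subseteq> {0<..<1}" using nd by (auto simp: D_def)
    fix z assume "z \<in> D"
    then obtain j where j: "1 \<le> j" "j \<le> N" "z = (real j + 0) / real (N + 1)" by (auto simp: D_def)
    show "T z = cosh_profile lam z"
      unfolding j(3) T_node using p_fun_eq_cosh_profile[OF lam, of "(real j + 0) / real (N + 1)"] nd[OF j(1,2)] by simp
    show "T1 z = - lam * sinh_profile lam z" unfolding j(3) by (rule T1_node[OF j(1,2)])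
  qed
  then have le: "p_fun lam x \<le> 1 * T x + 1 * (- (2 / lam))" if "0 \<le> x" "x \<le> 1" for x
    using p_fun_eq_cosh_profile[OF lam that] that by simp
  note rtp = real_trig_poly_lincomb[OF T(1) real_trig_poly_const, of 1 1 "- (2 / lam)"]
  show thesis
  proof (rule that[OF rtp])
    show "((\<lambda>x. 1 * T x + 1 * - (2 / lam)) has_real_derivative T1 x) (at x)" for x
      using T(2)[of x] by (auto intro!: derivative_eq_intros)
    show "m_poly lam N x = of_real (1 * T x + 1 * - (2 / lam))" for x
      by (simp add: m_poly_eq[OF lam] T(3))
    show "p_fun lam x \<le> 1 * T x + 1 * - (2 / lam)" for x
      using le_p_fun_of_unit_interval[OF rtp, of "\<lambda>u v. v \<le> u"] le by blast
    show "1 * T ((real j + 0) / real (N + 1)) + 1 * - (2 / lam) = p_fun lam ((real j + 0) / real (N + 1))" for j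
      unfolding T_node by simp
  qed (rule T1_node)
qed

lemma l_poly_interpolant:
  assumes lam: "lam > 0"
  obtains T T1 where "real_trig_poly N T" "\<And>x. (T has_real_derivative T1 x) (at x)"
    "\<And>x. l_poly lam N x = of_real (T x)" "\<And>x. T x \<le> p_fun lam x"
    "\<And>j::nat. T ((real j + 1/2) / real (N + 1)) = p_fun lam ((real j + 1/2) / real (N + 1))"
    "\<And>j. j \<le> N \<Longrightarrow> T1 ((real j + 1/2) / real (N + 1)) = - lam * sinh_profile lam ((real j + 1/2) / real (N + 1))"
proof -
  obtain T T1 where T: "real_trig_poly N T" "\<And>x. (T has_real_derivative T1 x) (at x)"
    "\<And>x. trig_interp (1/2) lam N x = of_real (T x)" "T1 0 = 0"
    and node: "\<And>j. T ((of_int j + 1/2) / real (N + 1)) = (\<Sum>\<^sub>\<infinity>m::int. exp (- lam * \<bar>(of_int j + 1/2) / real (N + 1) + of_int m\<bar>))"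
    and node1: "\<And>j. T1 ((of_int j + 1/2) / real (N + 1)) = - lam * (\<Sum>\<^sub>\<infinity>m::int. sgn ((of_int j + 1/2) / real (N + 1) + of_int m) *
         exp (- lam * \<bar>(of_int j + 1/2) / real (N + 1) + of_int m\<bar>))"
    using trig_interp_real[OF lam, of "1/2" 1 N] by auto
  have T_node: "T ((real j + 1/2) / real (N + 1)) = 2 / lam + p_fun lam ((real j + 1/2) / real (N + 1))" for j
    using node[of "int j"] by (simp add: p_fun_def)
  have nd: "0 < (real j + 1/2) / real (N + 1)" "(real j + 1/2) / real (N + 1) < 1" if "j \<le> N" for j
    using that by auto
  have T1_node: "T1 ((real j + 1/2) / real (N + 1)) = - lam * sinh_profile lam ((real j + 1/2) / real (N + 1))" if "j \<le> N" for j
    using node1[of "int j"] infsumI[OF has_sum_sgn_exp_abs[OF lam nd[OF that]]] by simp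
  define D where "D = (\<lambda>j. (real j + 1/2) / real (N + 1)) ` {..N}"
  have "T x \<le> cosh_profile lam x" if x: "0 \<le> x" "x \<le> 1" for x
  proof (rule interpolant_le_cosh_profile[OF lam T(1,2,4) _ _ _ _ _ x])
    show "finite D" "card D = N + 1" unfolding D_def card_nodes by simp_all
    show "D \<subseteq> {0<..<1}" using nd by (auto simp: D_def)
    fix z assume "z \<in> D"
    then obtain j where j: "j \<le> N" "z = (real j + 1/2) / real (N + 1)" by (auto simp: D_def)
    show "T z = cosh_profile lam z"
      unfolding j(2) T_node using p_fun_eq_cosh_profile[OF lam, of "(real j + 1/2) / real (N + 1)"] nd[OF j(1)] by simp
    show "T1 z = - lam * sinh_profile lam z" unfolding j(2) by (rule T1_node[OF j(1)])
  qed
  then have le: "1 * T x + 1 * (- (2 / lam)) \<le> p_fun lam x" if "0 \<le> x" "x \<le> 1" for x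
    using p_fun_eq_cosh_profile[OF lam that] that by simp
  note rtp = real_trig_poly_lincomb[OF T(1) real_trig_poly_const, of 1 1 "- (2 / lam)"]
  show thesis
  proof (rule that[OF rtp])
    show "((\<lambda>x. 1 * T x + 1 * - (2 / lam)) has_real_derivative T1 x) (at x)" for x
      using T(2)[of x] by (auto intro!: derivative_eq_intros)
    show "l_poly lam N x = of_real (1 * T x + 1 * - (2 / lam))" for x
      by (simp add: l_poly_eq[OF lam] T(3))
    show "1 * T x + 1 * - (2 / lam) \<le> p_fun lam x" for x
      using le_p_fun_of_unit_interval[OF rtp, of "(\<le>)"] le by blast
    show "1 * T ((real j + 1/2) / real (N + 1)) + 1 * - (2 / lam) = p_fun lam ((real j + 1/2) / real (N + 1))" for j
      unfolding T_node by simp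
  qed (rule T1_node)
qed

theorem theorem6p1:
  fixes lam :: real and N :: nat
  assumes "lam > 0"
  shows
    "(\<forall>x::real. l_poly lam N x \<le> complex_of_real (p_fun lam x) \<and>
                complex_of_real (p_fun lam x) \<le> m_poly lam N x)
   \<and> (\<forall>n\<in>{1..N+1}. l_poly lam N ((real n - 1/2) / real (N + 1))
                     = complex_of_real (p_fun lam ((real n - 1/2) / real (N + 1))))
   \<and> (\<forall>n\<in>{1..N+1}. complex_of_real (p_fun lam (real n / real (N + 1)))
                     = m_poly lam N (real n / real (N + 1)))
   \<and> (\<forall>lt. real_trig_poly N lt \<and> (\<forall>x. lt x \<le> p_fun lam x) \<longrightarrow>
          complex_of_real (circle_integral lt) \<le> circle_integral (l_poly lam N))
   \<and> (\<forall>mt. real_trig_poly N mt \<and> (\<forall>x. p_fun lam x \<le> mt x) \<longrightarrow>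
          circle_integral (m_poly lam N) \<le> complex_of_real (circle_integral mt))
   \<and> (\<forall>lt. real_trig_poly N lt \<and> (\<forall>x. lt x \<le> p_fun lam x) \<longrightarrow>
          (complex_of_real (circle_integral lt) = circle_integral (l_poly lam N) \<longleftrightarrow>
           (\<forall>x. complex_of_real (lt x) = l_poly lam N x)))
   \<and> (\<forall>mt. real_trig_poly N mt \<and> (\<forall>x. p_fun lam x \<le> mt x) \<longrightarrow>
          (circle_integral (m_poly lam N) = complex_of_real (circle_integral mt) \<longleftrightarrow>
           (\<forall>x. complex_of_real (mt x) = m_poly lam N x)))"
proof -
  obtain L L1 where L: "real_trig_poly N L" "\<And>x. (L has_real_derivative L1 x) (at x)"
    "\<And>x. l_poly lam N x = of_real (L x)" "\<And>x. L x \<le> p_fun lam x"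
    "\<And>j::nat. L ((real j + 1/2) / real (N + 1)) = p_fun lam ((real j + 1/2) / real (N + 1))"
    "\<And>j. j \<le> N \<Longrightarrow> L1 ((real j + 1/2) / real (N + 1)) = - lam * sinh_profile lam ((real j + 1/2) / real (N + 1))"
    using l_poly_interpolant[OF assms] by blast
  obtain M M1 where M: "real_trig_poly N M" "\<And>x. (M has_real_derivative M1 x) (at x)"
    "\<And>x. m_poly lam N x = of_real (M x)" "\<And>x. p_fun lam x \<le> M x"
    "\<And>j::nat. M ((real j + 0) / real (N + 1)) = p_fun lam ((real j + 0) / real (N + 1))"
    "\<And>j. 1 \<le> j \<Longrightarrow> j \<le> N \<Longrightarrow> M1 ((real j + 0) / real (N + 1)) = - lam * sinh_profile lam ((real j + 0) / real (N + 1))"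
    using m_poly_interpolant[OF assms] by blast
  have int_L: "circle_integral (l_poly lam N) = of_real (circle_integral L)"
    unfolding L(3)[abs_def] by (rule circle_integral_of_real)
  have int_M: "circle_integral (m_poly lam N) = of_real (circle_integral M)"
    unfolding M(3)[abs_def] by (rule circle_integral_of_real)
  have of_real_le: "complex_of_real a \<le> of_real b \<longleftrightarrow> a \<le> b" for a b
    by (simp add: less_eq_complex_def)
  \<comment> \<open>The index shifts by one, since n - 1/2 = (n - 1) + 1/2.\<close>
  have L_node: "L ((real n - 1/2) / real (N + 1)) = p_fun lam ((real n - 1/2) / real (N + 1))" if "n \<in> {1..N+1}" for n
    using L(5)[of "n - 1"] that by (simp add: of_nat_diff)
  have M_node: "M (real n / real (N + 1)) = p_fun lam (real n / real (N + 1))" for n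
    using M(5)[of n] by simp
  have L_ext: "circle_integral F \<le> circle_integral L" "circle_integral F = circle_integral L \<longleftrightarrow> (\<forall>x. F x = L x)"
    if "real_trig_poly N F" "\<forall>x. F x \<le> p_fun lam x" for F
    using interpolant_extremal[OF assms, of "1/2" N L L1 F 1] L that by auto
  have M_ext: "circle_integral M \<le> circle_integral F" "circle_integral M = circle_integral F \<longleftrightarrow> (\<forall>x. F x = M x)"
    if "real_trig_poly N F" "\<forall>x. p_fun lam x \<le> F x" for F
    using interpolant_extremal[OF assms, of 0 N M M1 F "-1"] M that by auto
  show ?thesis
    unfolding int_L int_M L(3) M(3) of_real_le of_real_eq_iff
    using L(4) M(4) L_node M_node L_ext M_ext by simp
qed

end
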